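(* Let $V_4=\mathbb{Z}_2\times\mathbb{Z}_2$ with $\mathbb{Z}_2=\{\pm1\}$, and let $E_{V_4}\subset C(V_4)\cong\mathbb{C}^4$ be the operator system of functions of the form $f(s,t)=a_0+s\,a_1+t\,a_2$ for $(s,t)\in V_4$, with $a_0,a_1,a_2\in\mathbb{C}$. Then: (1) the $C^*$-envelope of $E_{V_4}$ is $C(V_4)\cong\mathbb{C}^4$ (with the inclusion map); (2) $\pi_0(C(V_4)_h^\times)\cong\{\pm1\}^4$, so $|\pi_0(C(V_4)_h^\times)|=16$, whereas $|\pi_0((E_{V_4})_h^\times)|=14$; moreover, no $f\in(E_{V_4})_h^\times$ is strictly positive at both $(1,1)$ and $(-1,-1)$ and strictly negative at both $(1,-1)$ and $(-1,1)$, nor is any $f\in(E_{V_4})_h^\times$ strictly negative at both $(1,1)$ and $(-1,-1)$ and strictly positive at both $(1,-1)$ and $(-1,1)$; (3) $\pi_0((E_{V_4})^\times)$ and $\pi_0(C(V_4)^\times)$ each consist of a single element.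
   Context: A (concrete) operator system is a $*$-closed, norm-closed linear space of bounded operators on a Hilbert space containing the unit. Its $C^*$-envelope $C^*_{\mathrm{env}}(E)$, with a unital complete order embedding $\imath_E:E\to C^*_{\mathrm{env}}(E)$ whose image generates it, is the smallest $C^*$-algebra generated by a unital completely order isomorphic copy of $E$: for any unital complete order embedding $j:E\to B$ into a $C^*$-algebra $B$ generated by $j(E)$, there is a surjective $*$-homomorphism $\rho: B\to C^*_{\mathrm{env}}(E)$ with $\rho\circ j=\imath_E$. For an operator system $E$, $E^\times$ denotes the set of $x\in E$ such that $\imath_E(x)$ is invertible in $C^*_{\mathrm{env}}(E)$, and $E_h^\times$ denotes the set of self-adjoint elements of $E^\times$; both carry the norm topology. For a unital $C^*$-algebra $A$, its $C^*$-envelope is $A$ itself, so $A^\times$ is the set of invertible elements and $A_h^\times$ the set of invertible self-adjoint elements. $\pi_0$ denotes the set of path components. *)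

theory Defs
  imports "HOL-Analysis.Analysis"
begin

section \<open>Unital C*-algebras\<close>

text \<open>The base classes make the algebra a unital real Banach algebra with \<open>norm 1 = 1\<close>; in
  particular the zero algebra is excluded.\<close>

class cstar_algebra = real_normed_algebra_1 + banach +
  fixes scaleC :: "complex \<Rightarrow> 'a \<Rightarrow> 'a"  (infixr \<open>*\<^sub>C\<close> 75)
    and star :: "'a \<Rightarrow> 'a"
  assumes scaleC_add_right: "c *\<^sub>C (x + y) = c *\<^sub>C x + c *\<^sub>C y"
    and scaleC_add_left: "(c + d) *\<^sub>C x = c *\<^sub>C x + d *\<^sub>C x"
    and scaleC_scaleC: "c *\<^sub>C d *\<^sub>C x = (c * d) *\<^sub>C x"
    and scaleC_of_real: "complex_of_real r *\<^sub>C x = r *\<^sub>R x"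
    and mult_scaleC_left: "(c *\<^sub>C x) * y = c *\<^sub>C (x * y)"
    and mult_scaleC_right: "x * (c *\<^sub>C y) = c *\<^sub>C (x * y)"
    and norm_scaleC: "norm (c *\<^sub>C x) = cmod c * norm x"
    and star_star: "star (star x) = x"
    and star_add: "star (x + y) = star x + star y"
    and star_scaleC: "star (c *\<^sub>C x) = cnj c *\<^sub>C star x"
    and star_mult: "star (x * y) = star y * star x"
    and cstar_identity: "norm (star x * x) = (norm x)\<^sup>2"

instantiation complex :: cstar_algebra
begin

definition scaleC_complex :: "complex \<Rightarrow> complex \<Rightarrow> complex"
  where "scaleC_complex c z = c * z"

definition star_complex :: "complex \<Rightarrow> complex"
  where "star_complex z = cnj z"

instance
  by standard
    (auto simp: scaleC_complex_def star_complex_def algebra_simps norm_mult power2_eq_square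
      scaleR_conv_of_real)

end


section \<open>The C*-algebra of bounded continuous functions\<close>

lemma bcontfun_boundI:
  fixes h :: "'a::topological_space \<Rightarrow> 'b::real_normed_vector"
  assumes "continuous_on UNIV h" "\<And>x. norm (h x) \<le> b"
  shows "h \<in> bcontfun"
  using assms by (auto simp: bcontfun_def intro: boundedI)

instantiation bcontfun :: (topological_space, real_normed_algebra_1) real_normed_algebra_1
begin

definition times_bcontfun :: "('a \<Rightarrow>\<^sub>C 'b) \<Rightarrow> ('a \<Rightarrow>\<^sub>C 'b) \<Rightarrow> 'a \<Rightarrow>\<^sub>C 'b"
  where "times_bcontfun f g = Bcontfun (\<lambda>x. apply_bcontfun f x * apply_bcontfun g x)"

definition one_bcontfun :: "'a \<Rightarrow>\<^sub>C 'b"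
  where "one_bcontfun = const_bcontfun 1"

lemma apply_times_bcontfun [simp]:
  "apply_bcontfun (f * g) x = apply_bcontfun f x * apply_bcontfun g x" for f g :: "'a \<Rightarrow>\<^sub>C 'b"
proof -
  have "(\<lambda>x. apply_bcontfun f x * apply_bcontfun g x) \<in> bcontfun"
  proof (rule bcontfun_boundI)
    show "norm (apply_bcontfun f x * apply_bcontfun g x) \<le> norm f * norm g" for x
      by (rule order_trans[OF norm_mult_ineq]) (simp add: mult_mono norm_bounded)
  qed (intro continuous_intros continuous_on_apply_bcontfun)
  then show ?thesis
    by (simp add: times_bcontfun_def Bcontfun_inverse)
qed

lemma apply_one_bcontfun [simp]: "apply_bcontfun (1 :: 'a \<Rightarrow>\<^sub>C 'b) x = 1"
  by (simp add: one_bcontfun_def)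

instance
proof
  fix f g h :: "'a \<Rightarrow>\<^sub>C 'b" and r :: real
  show "f * g * h = f * (g * h)" "1 * f = f" "f * 1 = f"
    "(f + g) * h = f * h + g * h" "f * (g + h) = f * g + f * h"
    "r *\<^sub>R f * g = r *\<^sub>R (f * g)" "f * r *\<^sub>R g = r *\<^sub>R (f * g)"
    by (auto intro!: bcontfun_eqI simp: algebra_simps)
  show "(0 :: 'a \<Rightarrow>\<^sub>C 'b) \<noteq> 1"
  proof
    assume "(0 :: 'a \<Rightarrow>\<^sub>C 'b) = 1"
    then have "apply_bcontfun (0 :: 'a \<Rightarrow>\<^sub>C 'b) undefined = apply_bcontfun 1 undefined"
      by simp
    then show False by simp
  qed
  show "norm (f * g) \<le> norm f * norm g"
    by (rule norm_bound)
      (simp, rule order_trans[OF norm_mult_ineq], simp add: mult_mono norm_bounded)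
  show "norm (1 :: 'a \<Rightarrow>\<^sub>C 'b) = 1"
  proof (rule antisym)
    show "norm (1 :: 'a \<Rightarrow>\<^sub>C 'b) \<le> 1"
      by (rule norm_bound) simp
    show "1 \<le> norm (1 :: 'a \<Rightarrow>\<^sub>C 'b)"
      using norm_bounded[of "1 :: 'a \<Rightarrow>\<^sub>C 'b" undefined] by simp
  qed
qed

end

lemma norm_star [simp]: "norm (star x) = norm (x :: 'a::cstar_algebra)"
proof -
  have le: "norm y \<le> norm (star y)" for y :: 'a
  proof (cases "y = 0")
    case False
    have "norm y * norm y \<le> norm (star y) * norm y"
      using norm_mult_ineq[of "star y" y] by (simp add: cstar_identity power2_eq_square)
    then show ?thesis using False by simp
  qed simp
  show ?thesis
    using le[of x] le[of "star x"] by (simp add: star_star)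
qed

lemma star_diff: "star (x - y) = star x - star (y :: 'a::cstar_algebra)"
  using star_add[of "x - y" y] by simp

lemma bcontfun_scaleC:
  fixes f :: "'a::topological_space \<Rightarrow>\<^sub>C 'b::cstar_algebra"
  shows "(\<lambda>x. c *\<^sub>C apply_bcontfun f x) \<in> bcontfun"
proof (rule bcontfun_boundI)
  have "bounded_linear (\<lambda>x :: 'b. c *\<^sub>C x)"
  proof (rule bounded_linear_intro)
    show "norm (c *\<^sub>C x) \<le> norm x * cmod c" for x :: 'b
      by (simp add: norm_scaleC mult.commute)
    show "c *\<^sub>C (r *\<^sub>R x) = r *\<^sub>R (c *\<^sub>C x)" for r and x :: 'b
      by (simp add: scaleC_of_real[symmetric] scaleC_scaleC mult.commute)
  qed (simp add: scaleC_add_right)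
  then show "continuous_on UNIV (\<lambda>x. c *\<^sub>C apply_bcontfun f x)"
    by (rule bounded_linear.continuous_on) simp
  show "norm (c *\<^sub>C apply_bcontfun f x) \<le> cmod c * norm f" for x
    by (simp add: norm_scaleC mult_left_mono norm_bounded)
qed

lemma bcontfun_star:
  fixes f :: "'a::topological_space \<Rightarrow>\<^sub>C 'b::cstar_algebra"
  shows "(\<lambda>x. star (apply_bcontfun f x)) \<in> bcontfun"
proof (rule bcontfun_boundI)
  have "bounded_linear (star :: 'b \<Rightarrow> 'b)"
  proof (rule bounded_linear_intro)
    show "star (r *\<^sub>R x) = r *\<^sub>R star x" for r and x :: 'b
      by (simp add: scaleC_of_real[symmetric] star_scaleC)
    show "norm (star x) \<le> norm x * 1" for x :: 'b
      by simp
  qed (simp add: star_add)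
  then show "continuous_on UNIV (\<lambda>x. star (apply_bcontfun f x))"
    by (rule bounded_linear.continuous_on) simp
  show "norm (star (apply_bcontfun f x)) \<le> norm f" for x
    by (simp add: norm_bounded)
qed

instance bcontfun :: (metric_space, banach) banach ..

instantiation bcontfun :: (metric_space, cstar_algebra) cstar_algebra
begin

definition scaleC_bcontfun :: "complex \<Rightarrow> ('a \<Rightarrow>\<^sub>C 'b) \<Rightarrow> 'a \<Rightarrow>\<^sub>C 'b"
  where "scaleC_bcontfun c f = Bcontfun (\<lambda>x. c *\<^sub>C apply_bcontfun f x)"

definition star_bcontfun :: "('a \<Rightarrow>\<^sub>C 'b) \<Rightarrow> 'a \<Rightarrow>\<^sub>C 'b"
  where "star_bcontfun f = Bcontfun (\<lambda>x. star (apply_bcontfun f x))"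

lemma apply_scaleC_bcontfun [simp]:
  "apply_bcontfun (c *\<^sub>C f) x = c *\<^sub>C apply_bcontfun f x" for f :: "'a \<Rightarrow>\<^sub>C 'b"
  by (simp add: scaleC_bcontfun_def Bcontfun_inverse bcontfun_scaleC)

lemma apply_star_bcontfun [simp]:
  "apply_bcontfun (star f) x = star (apply_bcontfun f x)" for f :: "'a \<Rightarrow>\<^sub>C 'b"
  by (simp add: star_bcontfun_def Bcontfun_inverse bcontfun_star)

instance
proof
  fix f g :: "'a \<Rightarrow>\<^sub>C 'b" and c d :: complex and r :: real
  show "c *\<^sub>C (f + g) = c *\<^sub>C f + c *\<^sub>C g" "(c + d) *\<^sub>C f = c *\<^sub>C f + d *\<^sub>C f"
    "c *\<^sub>C d *\<^sub>C f = (c * d) *\<^sub>C f" "complex_of_real r *\<^sub>C f = r *\<^sub>R f"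
    "(c *\<^sub>C f) * g = c *\<^sub>C (f * g)" "f * (c *\<^sub>C g) = c *\<^sub>C (f * g)"
    "star (star f) = f" "star (f + g) = star f + star g"
    "star (c *\<^sub>C f) = cnj c *\<^sub>C star f" "star (f * g) = star g * star f"
    by (auto intro!: bcontfun_eqI simp: scaleC_add_right scaleC_add_left scaleC_scaleC
        scaleC_of_real mult_scaleC_left mult_scaleC_right star_star star_add star_scaleC star_mult)
  show "norm (c *\<^sub>C f) = cmod c * norm f"
  proof (rule antisym)
    show "norm (c *\<^sub>C f) \<le> cmod c * norm f"
      by (rule norm_bound) (simp add: norm_scaleC mult_left_mono norm_bounded)
    show "cmod c * norm f \<le> norm (c *\<^sub>C f)"
    proof (cases "c = 0")
      case False
      have "norm f \<le> norm (c *\<^sub>C f) / cmod c"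
      proof (rule norm_bound)
        fix x
        have "cmod c * norm (apply_bcontfun f x) \<le> norm (c *\<^sub>C f)"
          using norm_bounded[of "c *\<^sub>C f" x] by (simp add: norm_scaleC)
        then show "norm (apply_bcontfun f x) \<le> norm (c *\<^sub>C f) / cmod c"
          using False by (simp add: field_simps)
      qed
      then show ?thesis using False by (simp add: field_simps)
    qed simp
  qed
  show "norm (star f * f) = (norm f)\<^sup>2"
  proof (rule antisym)
    show "norm (star f * f) \<le> (norm f)\<^sup>2"
      by (rule norm_bound) (simp add: cstar_identity power_mono norm_bounded)
    have "norm f \<le> sqrt (norm (star f * f))"
    proof (rule norm_bound)
      show "norm (apply_bcontfun f x) \<le> sqrt (norm (star f * f))" for x
        using norm_bounded[of "star f * f" x] by (simp add: cstar_identity real_le_rsqrt)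
    qed
    then show "(norm f)\<^sup>2 \<le> norm (star f * f)"
      using power_mono[OF _ norm_ge_zero, of f _ 2] by fastforce
  qed
qed

end


section \<open>Operator systems and C*-envelopes\<close>

text \<open>An \<open>n \<times> n\<close> matrix is a function \<open>nat \<Rightarrow> nat \<Rightarrow> 'a\<close> of which only the entries with both
  indices below \<open>n\<close> matter. It is positive in the C*-algebra \<open>M\<^sub>n(A)\<close> iff it is of the
  form \<open>Y\<^sup>* Y\<close>.\<close>

definition mat_positive :: "nat \<Rightarrow> (nat \<Rightarrow> nat \<Rightarrow> 'a::cstar_algebra) \<Rightarrow> bool" where
  "mat_positive n X \<longleftrightarrow> (\<exists>Y. \<forall>i<n. \<forall>j<n. X i j = (\<Sum>k<n. star (Y k i) * Y k j))"

text \<open>The concrete operator systems: the ambient space is any unital C*-algebra, for instance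
  the algebra of bounded operators on a Hilbert space, and the matrix order of the operator system
  is the one inherited from it.\<close>

definition operator_system :: "'a::cstar_algebra set \<Rightarrow> bool" where
  "operator_system E \<longleftrightarrow>
     1 \<in> E \<and> (\<forall>x\<in>E. \<forall>y\<in>E. x + y \<in> E) \<and> (\<forall>c. \<forall>x\<in>E. c *\<^sub>C x \<in> E) \<and>
     (\<forall>x\<in>E. star x \<in> E) \<and> closed E"

definition unital_complete_order_embedding ::
  "'a::cstar_algebra set \<Rightarrow> ('a \<Rightarrow> 'b::cstar_algebra) \<Rightarrow> bool" where
  "unital_complete_order_embedding E \<phi> \<longleftrightarrow>
     (\<forall>x\<in>E. \<forall>y\<in>E. \<phi> (x + y) = \<phi> x + \<phi> y) \<and> (\<forall>c. \<forall>x\<in>E. \<phi> (c *\<^sub>C x) = c *\<^sub>C \<phi> x) \<and>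
     \<phi> 1 = 1 \<and> inj_on \<phi> E \<and>
     (\<forall>n X. (\<forall>i<n. \<forall>j<n. X i j \<in> E) \<longrightarrow>
        (mat_positive n (\<lambda>i j. \<phi> (X i j)) \<longleftrightarrow> mat_positive n X))"

definition cstar_subalgebra :: "'a::cstar_algebra set \<Rightarrow> bool" where
  "cstar_subalgebra D \<longleftrightarrow>
     0 \<in> D \<and> (\<forall>x\<in>D. \<forall>y\<in>D. x + y \<in> D) \<and> (\<forall>c. \<forall>x\<in>D. c *\<^sub>C x \<in> D) \<and>
     (\<forall>x\<in>D. \<forall>y\<in>D. x * y \<in> D) \<and> (\<forall>x\<in>D. star x \<in> D) \<and> closed D"

definition star_hom :: "('a::cstar_algebra \<Rightarrow> 'b::cstar_algebra) \<Rightarrow> bool" where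
  "star_hom \<rho> \<longleftrightarrow>
     (\<forall>x y. \<rho> (x + y) = \<rho> x + \<rho> y) \<and> (\<forall>c x. \<rho> (c *\<^sub>C x) = c *\<^sub>C \<rho> x) \<and>
     (\<forall>x y. \<rho> (x * y) = \<rho> x * \<rho> y) \<and> (\<forall>x. \<rho> (star x) = star (\<rho> x))"

text \<open>\<open>cstar_envelope TYPE('b) E \<iota>\<close>: the codomain \<open>'c\<close> of \<open>\<iota>\<close>, together with \<open>\<iota>\<close>, is the
  C*-envelope of \<open>E\<close>. Quantification over types being impossible inside a formula, the C*-algebras
  \<open>B\<close> of the universal property are those carried by the type \<open>'b\<close>; a theorem asserting this
  property for a type variable \<open>'b\<close> asserts it for all C*-algebras \<open>B\<close>.\<close>

definition cstar_envelope ::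
  "'b::cstar_algebra itself \<Rightarrow> 'a::cstar_algebra set \<Rightarrow> ('a \<Rightarrow> 'c::cstar_algebra) \<Rightarrow> bool" where
  "cstar_envelope _ E \<iota> \<longleftrightarrow>
     operator_system E \<and> unital_complete_order_embedding E \<iota> \<and>
     cstar_subalgebra hull (\<iota> ` E) = UNIV \<and>
     (\<forall>j :: 'a \<Rightarrow> 'b.
        unital_complete_order_embedding E j \<and> cstar_subalgebra hull (j ` E) = UNIV \<longrightarrow>
        (\<exists>\<rho> :: 'b \<Rightarrow> 'c. star_hom \<rho> \<and> surj \<rho> \<and> (\<forall>x\<in>E. \<rho> (j x) = \<iota> x)))"

text \<open>\<open>E\<^sup>\<times>\<close> and its self-adjoint part, for an operator system \<open>E\<close> whose C*-envelope is given by
  \<open>\<iota>\<close>.\<close>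

definition env_units :: "'a::cstar_algebra set \<Rightarrow> ('a \<Rightarrow> 'c::cstar_algebra) \<Rightarrow> 'a set" where
  "env_units E \<iota> = {x \<in> E. \<exists>y. \<iota> x * y = 1 \<and> y * \<iota> x = 1}"

definition env_units_sa :: "'a::cstar_algebra set \<Rightarrow> ('a \<Rightarrow> 'c::cstar_algebra) \<Rightarrow> 'a set" where
  "env_units_sa E \<iota> = {x \<in> env_units E \<iota>. star x = x}"

definition cstar_units :: "'a::cstar_algebra set" where
  "cstar_units = {x. \<exists>y. x * y = 1 \<and> y * x = 1}"

definition cstar_units_sa :: "'a::cstar_algebra set" where
  "cstar_units_sa = {x \<in> cstar_units. star x = x}"

definition pi0 :: "'a::topological_space set \<Rightarrow> 'a set set" where
  "pi0 S = path_components_of (top_of_set S)"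


section \<open>The group \<open>V\<^sub>4\<close> and the operator system \<open>E\<^bsub>V\<^sub>4\<^esub>\<close>\<close>

typedef z2 = "{1, -1 :: int}" morphisms z2_val Abs_z2
  by auto

instantiation z2 :: "{one, uminus, times, finite, metric_space}"
begin

definition one_z2 :: z2
  where "1 = Abs_z2 1"

definition uminus_z2 :: "z2 \<Rightarrow> z2"
  where "- s = Abs_z2 (- z2_val s)"

definition times_z2 :: "z2 \<Rightarrow> z2 \<Rightarrow> z2"
  where "s * t = Abs_z2 (z2_val s * z2_val t)"

definition dist_z2 :: "z2 \<Rightarrow> z2 \<Rightarrow> real"
  where "dist s t = \<bar>real_of_int (z2_val s) - real_of_int (z2_val t)\<bar>"

definition uniformity_z2 :: "(z2 \<times> z2) filter"
  where "uniformity = (INF e\<in>{0 <..}. principal {(s :: z2, t). dist s t < e})"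

definition open_z2 :: "z2 set \<Rightarrow> bool"
  where "open_z2 U = (\<forall>x\<in>U. \<forall>\<^sub>F (x', y) in uniformity. x' = x \<longrightarrow> y \<in> U)"

instance
proof
  have "(UNIV :: z2 set) = Abs_z2 ` {1, -1}"
    using type_definition.Abs_image[OF type_definition_z2] by simp
  then show "finite (UNIV :: z2 set)"
    by (metis finite.emptyI finite.insertI finite_imageI)
qed (auto simp: dist_z2_def uniformity_z2_def open_z2_def z2_val_inject)

end

lemma z2_val_simps [simp]:
  "z2_val 1 = 1" "z2_val (- s) = - z2_val s" "z2_val (s * t) = z2_val s * z2_val t"
  using z2_val[of s] z2_val[of t]
  by (auto simp: one_z2_def uminus_z2_def times_z2_def Abs_z2_inverse)

type_synonym v4 = "z2 \<times> z2"

text \<open>\<open>V\<^sub>4\<close> is a finite discrete space, so \<open>v4 \<Rightarrow>\<^sub>C complex\<close> consists of all functions on it.\<close>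

lemma v4_all_bcontfun: "(f :: v4 \<Rightarrow> complex) \<in> bcontfun"
proof -
  have "open {x}" for x :: v4
    using finite_imp_closed[of "UNIV - {x}"] by (simp add: closed_def Diff_eq)
  then have "continuous_on UNIV f"
    by (simp add: continuous_on_eq_continuous_at isCont_def tendsto_def at_discrete eventually_at_filter
        eventually_nhds) (metis (mono_tags) singletonD singletonI)
  then show ?thesis
    by (simp add: bcontfun_def finite_imp_bounded)
qed

definition E_V4 :: "(v4 \<Rightarrow>\<^sub>C complex) set" where
  "E_V4 = {f. \<exists>a0 a1 a2 :: complex. \<forall>s t.
     apply_bcontfun f (s, t) = a0 + of_int (z2_val s) * a1 + of_int (z2_val t) * a2}"

end

(*
Let u, v be the images of the coordinate functions s, t in a C*-algebra B generated by a copy of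
E_V4. At a corner (x, y) of the square the function (2 + x s + y t) / 4 peaks with value 1, so its
image e is positive of norm exactly 1, and the powers of e are approximate joint eigenvectors of u
and v for the eigenvalues x and y. The elements of B having the powers of e as approximate
eigenvectors form a C*-subalgebra, hence all of B, and the eigenvalue is a character of B. The four
characters obtained in this way make up the homomorphism onto C(V_4).

The image of E_V4 in C^4 is given by f(1,1) + f(-1,-1) = f(1,-1) + f(-1,1), which excludes exactly
the two alternating sign patterns.
*)

theory Submission
  imports Defs
begin

section \<open>Positive elements of a C*-algebra\<close>

text \<open>The images \<open>u\<close> and \<open>v\<close> are not known to commute, so neither a
  joint spectrum nor products of peaking functions can be carried over to \<open>B\<close>: what
  survives the passage is the order. A function vanishing at the corner, such as 1 - x s, lies
  between 0 and 4 (1 - e), and \<open>e ^ n * (1 - e) * e ^ n\<close> has norm at most 1/n, the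
  operator form of t^(2n) (1 - t) \<le> 1/n on [0,1]. Hence (1 - x u) e^n tends to 0, while
  \<open>norm e = 1\<close> and the C*-identity keep e^n itself at norm 1; the limit is therefore an
  honest eigenvalue equation. These estimates need square roots, monotonicity of the norm and
  order-preserving conjugation in an algebra given by axioms alone. They are derived from the norm,
  without spectra: roots come from an iteration, and positivity of \<open>star y * y\<close> links
  the resulting cone to \<open>mat_positive\<close>, through 1x1 matrices.\<close>

lemma scaleC_zero_left [simp]: "0 *\<^sub>C x = (0 :: 'a::cstar_algebra)"
  using scaleC_of_real[of 0 x] by simp

lemma scaleC_one [simp]: "1 *\<^sub>C x = (x :: 'a::cstar_algebra)"
  using scaleC_of_real[of 1 x] by simp

lemma scaleC_diff_right: "c *\<^sub>C (x - y) = c *\<^sub>C x - c *\<^sub>C (y :: 'a::cstar_algebra)"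
  using scaleC_add_right[of c "x - y" y] by simp

lemma scaleC_diff_left: "(c - d) *\<^sub>C x = c *\<^sub>C x - d *\<^sub>C (x :: 'a::cstar_algebra)"
  using scaleC_add_left[of "c - d" d x] by simp

lemma star_scaleR: "star (r *\<^sub>R x) = r *\<^sub>R star (x :: 'a::cstar_algebra)"
  by (simp add: scaleC_of_real[symmetric] star_scaleC)

lemma star_zero [simp]: "star (0 :: 'a::cstar_algebra) = 0"
  using star_scaleR[of 0 "0 :: 'a"] by simp

lemma star_minus: "star (- x) = - star (x :: 'a::cstar_algebra)"
  using star_diff[of 0 x] by simp

lemma star_one [simp]: "star (1 :: 'a::cstar_algebra) = 1"
  by (metis mult.right_neutral star_mult star_star mult.left_neutral)

lemma star_power: "star (x ^ n) = star (x :: 'a::cstar_algebra) ^ n"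
  by (induction n) (simp_all add: star_mult power_commutes)

lemma bounded_linear_star: "bounded_linear (star :: 'a::cstar_algebra \<Rightarrow> 'a)"
  by (rule bounded_linear_intro[of _ 1]) (simp_all add: star_add star_scaleR)

lemmas tendsto_star = bounded_linear.tendsto[OF bounded_linear_star]

lemma norm_square_selfadjoint:
  fixes x :: "'a::cstar_algebra"
  assumes "star x = x"
  shows "norm (x * x) = (norm x)\<^sup>2"
  using cstar_identity[of x] assms by simp

section \<open>Square roots of 1 - x by iteration\<close>

text \<open>For \<open>norm x \<le> 1\<close> the iterates converge to \<open>1 - sqrt (1 - x)\<close>. They are polynomials in
  \<open>x\<close> with nonnegative coefficients, so the scalar iteration at \<open>1\<close> dominates them.\<close>

primrec sqrt_iter :: "'a::real_normed_algebra_1 \<Rightarrow> nat \<Rightarrow> 'a" where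
  "sqrt_iter x 0 = 0"
| "sqrt_iter x (Suc n) = (1/2) *\<^sub>R (x + sqrt_iter x n * sqrt_iter x n)"

text \<open>The iterates are polynomials with the same coefficients for every argument. The form
  with two elements \<open>x\<close> and \<open>y\<close>, rather than one commuting with
  \<open>z\<close>, is what later compares \<open>star z * z\<close> with
  \<open>z * star z\<close>.\<close>

lemma sqrt_iter_intertwine:
  assumes "z * x = y * z"
  shows "z * sqrt_iter x n = sqrt_iter y n * z"
proof (induction n)
  case (Suc n)
  have "z * (sqrt_iter x n * sqrt_iter x n) = sqrt_iter y n * sqrt_iter y n * z"
    by (metis Suc mult.assoc)
  then show ?case using assms by (simp add: algebra_simps)
qed simp

lemma sqrt_iter_commute: "sqrt_iter x m * sqrt_iter x n = sqrt_iter x n * sqrt_iter x m"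
  by (metis sqrt_iter_intertwine)

lemma sqrt_iter_one_bounds:
  "0 \<le> sqrt_iter (1::real) n" "sqrt_iter (1::real) n \<le> 1"
  "sqrt_iter (1::real) n \<le> sqrt_iter 1 (Suc n)"
proof -
  have "0 \<le> sqrt_iter (1::real) n \<and> sqrt_iter (1::real) n \<le> 1"
  proof (induction n)
    case (Suc n)
    then have "sqrt_iter (1::real) n * sqrt_iter 1 n \<le> 1"
      by (simp add: mult_le_one)
    then show ?case using Suc by simp
  qed simp
  \<comment> \<open>Monotonicity: consecutive scalar iterates differ by half of this square.\<close>
  moreover have "0 \<le> (sqrt_iter (1::real) n - 1)\<^sup>2" by simp
  ultimately show "0 \<le> sqrt_iter (1::real) n" "sqrt_iter (1::real) n \<le> 1"
    "sqrt_iter (1::real) n \<le> sqrt_iter 1 (Suc n)"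
    by (auto simp: power2_eq_square algebra_simps)
qed

lemma norm_sqrt_iter_le:
  assumes "norm x \<le> 1"
  shows "norm (sqrt_iter x n) \<le> sqrt_iter 1 n"
proof (induction n)
  case (Suc n)
  have "norm (x + sqrt_iter x n * sqrt_iter x n) \<le> 1 + sqrt_iter 1 n * sqrt_iter 1 n"
    by (intro norm_triangle_le add_mono assms order_trans[OF norm_mult_ineq] mult_mono Suc
        sqrt_iter_one_bounds norm_ge_zero)
  then show ?case by simp
qed simp

text \<open>Iterates commute, so a difference of squares factors as
  \<open>(b - a) * (b + a)\<close>; each factor is bounded by its scalar counterpart.\<close>

lemma norm_sqrt_iter_step_le:
  assumes "norm x \<le> 1"
  shows "norm (sqrt_iter x (Suc n) - sqrt_iter x n) \<le> sqrt_iter 1 (Suc n) - sqrt_iter 1 n"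
proof (induction n)
  case 0
  then show ?case using assms by simp
next
  case (Suc n)
  let ?a = "sqrt_iter x n" and ?b = "sqrt_iter x (Suc n)"
  let ?\<alpha> = "sqrt_iter (1::real) n" and ?\<beta> = "sqrt_iter (1::real) (Suc n)"
  have "sqrt_iter x (Suc (Suc n)) - ?b = (1/2) *\<^sub>R (?b * ?b - ?a * ?a)"
    by (simp only: sqrt_iter.simps(2)[of x "Suc n"] sqrt_iter.simps(2)[of x n])
      (simp add: algebra_simps)
  also have "?b * ?b - ?a * ?a = (?b - ?a) * (?b + ?a)"
    using sqrt_iter_commute[of x "Suc n" n] by (simp only: ring_distribs) simp
  finally have eq: "sqrt_iter x (Suc (Suc n)) - ?b = (1/2) *\<^sub>R ((?b - ?a) * (?b + ?a))" .
  have "norm ((?b - ?a) * (?b + ?a)) \<le> (?\<beta> - ?\<alpha>) * (?\<beta> + ?\<alpha>)"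
    using sqrt_iter_one_bounds(3)[of n]
    by (intro order_trans[OF norm_mult_ineq] mult_mono Suc norm_triangle_le add_mono
        norm_sqrt_iter_le assms norm_ge_zero) linarith
  moreover have "sqrt_iter 1 (Suc (Suc n)) - ?\<beta> = (1/2) * ((?\<beta> - ?\<alpha>) * (?\<beta> + ?\<alpha>))"
    by (simp only: sqrt_iter.simps(2)[of 1 "Suc n"] sqrt_iter.simps(2)[of 1 n])
      (simp add: algebra_simps)
  ultimately show ?case unfolding eq by simp
qed

text \<open>The scalar iteration is bounded and monotone, so its increments are summable and
  majorise the increments for \<open>x\<close>.\<close>

lemma convergent_sqrt_iter:
  fixes x :: "'a::{real_normed_algebra_1, banach}"
  assumes "norm x \<le> 1"
  shows "convergent (sqrt_iter x)"
proof -
  have "convergent (sqrt_iter (1::real))"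
    by (rule Bseq_monoseq_convergent)
      (auto intro!: BseqI'[of _ 1] incseq_imp_monoseq incseq_SucI simp: sqrt_iter_one_bounds
        simp del: sqrt_iter.simps)
  then have "summable (\<lambda>n. sqrt_iter 1 (Suc n) - sqrt_iter (1::real) n)"
    by (simp only: telescope_summable convergent_LIMSEQ_iff)
  then have "summable (\<lambda>n. sqrt_iter x (Suc n) - sqrt_iter x n)"
    by (rule summable_comparison_test'[of _ 0]) (rule norm_sqrt_iter_step_le[OF assms])
  then have "convergent (\<lambda>n. \<Sum>k<n. sqrt_iter x (Suc k) - sqrt_iter x k)"
    by (simp only: summable_iff_convergent)
  then show ?thesis by (simp only: sum_lessThan_telescope sqrt_iter.simps(1) diff_0_right)
qed

definition sqrt_one_minus :: "'a::{real_normed_algebra_1, banach} \<Rightarrow> 'a" where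
  "sqrt_one_minus x = 1 - lim (sqrt_iter x)"

context
  fixes x :: "'a::{real_normed_algebra_1, banach}"
  assumes x: "norm x \<le> 1"
begin

lemma sqrt_iter_tendsto: "sqrt_iter x \<longlonglongrightarrow> lim (sqrt_iter x)"
  using convergent_sqrt_iter[OF x] by (simp only: convergent_LIMSEQ_iff)

lemma norm_one_minus_sqrt: "norm (1 - sqrt_one_minus x) \<le> 1"
proof -
  have "norm (sqrt_iter x n) \<le> 1" for n
    using norm_sqrt_iter_le[OF x, of n] sqrt_iter_one_bounds(2)[of n] by linarith
  then show ?thesis
    using Lim_norm_ubound[OF _ sqrt_iter_tendsto, of 1] by (simp add: sqrt_one_minus_def)
qed

text \<open>The limit \<open>r\<close> satisfies 2 r = x + r^2, which is (1 - r)^2 = 1 - x.\<close>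

lemma sqrt_one_minus_square: "sqrt_one_minus x * sqrt_one_minus x = 1 - x"
proof -
  let ?r = "lim (sqrt_iter x)"
  have "(\<lambda>n. sqrt_iter x (Suc n)) \<longlonglongrightarrow> (1/2) *\<^sub>R (x + ?r * ?r)"
    unfolding sqrt_iter.simps by (intro tendsto_intros sqrt_iter_tendsto)
  then have "?r = (1/2) *\<^sub>R (x + ?r * ?r)"
    by (rule LIMSEQ_unique[OF LIMSEQ_Suc[OF sqrt_iter_tendsto]])
  then have "2 *\<^sub>R ?r = 2 *\<^sub>R ((1/2) *\<^sub>R (x + ?r * ?r))" by (rule arg_cong)
  then have "?r + ?r = x + ?r * ?r" by (simp add: scaleR_2)
  then show ?thesis
    by (simp add: sqrt_one_minus_def algebra_simps scaleR_2)
qed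

end

lemma sqrt_one_minus_intertwine:
  assumes "norm x \<le> 1" "norm y \<le> 1" "z * x = y * z"
  shows "z * sqrt_one_minus x = sqrt_one_minus y * z"
proof -
  have "(\<lambda>n. z * sqrt_iter x n) \<longlonglongrightarrow> z * lim (sqrt_iter x)"
    by (intro tendsto_intros sqrt_iter_tendsto assms)
  moreover have "(\<lambda>n. z * sqrt_iter x n) \<longlonglongrightarrow> lim (sqrt_iter y) * z"
    unfolding sqrt_iter_intertwine[OF assms(3)] by (intro tendsto_intros sqrt_iter_tendsto assms)
  ultimately have "z * lim (sqrt_iter x) = lim (sqrt_iter y) * z"
    by (rule LIMSEQ_unique)
  then show ?thesis by (simp add: sqrt_one_minus_def algebra_simps)
qed

lemma star_sqrt_one_minus:
  fixes x :: "'a::cstar_algebra"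
  assumes "norm x \<le> 1" "star x = x"
  shows "star (sqrt_one_minus x) = sqrt_one_minus x"
proof -
  have "star (sqrt_iter x n) = sqrt_iter x n" for n
    by (induction n) (simp_all add: star_scaleR star_add star_mult assms)
  then have "star (lim (sqrt_iter x)) = lim (sqrt_iter x)"
    using tendsto_star[OF sqrt_iter_tendsto[OF assms(1)]] sqrt_iter_tendsto[OF assms(1)]
    by (simp add: LIMSEQ_unique)
  then show ?thesis by (simp add: sqrt_one_minus_def star_diff)
qed

text \<open>Here \<open>r\<close> is the real part of \<open>w = r + i q\<close>, so its norm is at
  most that of \<open>w\<close>; commutation cancels the cross terms of
  \<open>star w * w\<close>.\<close>

lemma norm_le_norm_sum_squares:
  fixes r q :: "'a::cstar_algebra"
  assumes "star r = r" "star q = q" "r * q = q * r"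
  shows "(norm r)\<^sup>2 \<le> norm (r * r + q * q)"
proof -
  define w where "w = r + \<i> *\<^sub>C q"
  have sw: "star w = r + (- \<i>) *\<^sub>C q"
    by (simp add: w_def star_add star_scaleC assms)
  have canc: "(- \<i>) *\<^sub>C y + \<i> *\<^sub>C y = 0" for y :: 'a
    unfolding scaleC_add_left[symmetric] by simp
  have "star w * w = r * r + q * q + ((- \<i>) *\<^sub>C (q * r) + \<i> *\<^sub>C (q * r))"
    unfolding sw unfolding w_def
    by (simp add: distrib_left distrib_right mult_scaleC_left mult_scaleC_right scaleC_scaleC
        scaleC_add_right assms(3))
  then have "(norm w)\<^sup>2 = norm (r * r + q * q)"
    by (simp add: cstar_identity[symmetric] canc)
  moreover have "w + star w = r + r + ((- \<i>) *\<^sub>C q + \<i> *\<^sub>C q)"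
    unfolding sw unfolding w_def by simp
  then have "norm (2 *\<^sub>R r) \<le> norm w + norm w"
    by (metis add_0_right canc norm_star norm_triangle_ineq scaleR_2)
  then have "norm r \<le> norm w" by simp
  ultimately show ?thesis by (metis norm_ge_zero power_mono)
qed

section \<open>The positive cone, described by the norm\<close>

text \<open>This norm condition describes the positive cone without reference to spectra, and makes
  closure under sums evident.\<close>

definition positive :: "'a::cstar_algebra \<Rightarrow> bool" where
  "positive h \<longleftrightarrow> star h = h \<and> (\<exists>t\<ge>0. norm (t *\<^sub>R 1 - h) \<le> t)"

lemma positive_star: "positive h \<Longrightarrow> star h = h"
  by (simp add: positive_def)

lemma positive_shift:
  fixes h :: "'a::cstar_algebra"
  assumes "norm (t *\<^sub>R 1 - h) \<le> t" "t \<le> t'"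
  shows "norm (t' *\<^sub>R 1 - h) \<le> t'"
proof -
  have "t' *\<^sub>R 1 - h = (t' - t) *\<^sub>R 1 + (t *\<^sub>R 1 - h)" by (simp add: algebra_simps)
  then have "norm (t' *\<^sub>R 1 - h) \<le> norm ((t' - t) *\<^sub>R (1::'a)) + norm (t *\<^sub>R 1 - h)"
    by (metis norm_triangle_ineq)
  then show ?thesis using assms by simp
qed

lemma positive_add:
  assumes "positive a" "positive b"
  shows "positive (a + b)"
proof -
  obtain t s where ts: "t \<ge> 0" "s \<ge> 0" "norm (t *\<^sub>R 1 - a) \<le> t" "norm (s *\<^sub>R 1 - b) \<le> s"
    using assms by (auto simp: positive_def)
  have "norm ((t + s) *\<^sub>R 1 - (a + b)) \<le> norm (t *\<^sub>R 1 - a) + norm (s *\<^sub>R 1 - b)"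
    using norm_triangle_ineq[of "t *\<^sub>R 1 - a" "s *\<^sub>R 1 - b"] by (simp add: algebra_simps)
  then have "norm ((t + s) *\<^sub>R 1 - (a + b)) \<le> t + s" using ts by linarith
  then show ?thesis using assms ts
    by (auto simp: positive_def star_add intro!: exI[of _ "t + s"])
qed

lemma positive_scaleR:
  assumes "positive a" "c \<ge> 0"
  shows "positive (c *\<^sub>R a)"
proof -
  obtain t where t: "t \<ge> 0" "norm (t *\<^sub>R 1 - a) \<le> t"
    using assms by (auto simp: positive_def)
  have "norm (c *\<^sub>R (t *\<^sub>R 1 - a)) \<le> c * t" using t assms by (simp add: mult_left_mono)
  then show ?thesis using assms t
    by (auto simp: positive_def star_scaleR algebra_simps intro!: exI[of _ "c * t"])
qed

lemma positive_norm_diff: "star b = b \<Longrightarrow> positive (norm b *\<^sub>R 1 - b)"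
  by (auto simp: positive_def star_diff star_scaleR intro!: exI[of _ "norm b"])

text \<open>The square root of \<open>h\<close> when \<open>t\<close> witnesses its positivity. The
  witness stays explicit because roots of two different elements are intertwined only when both are
  computed with the same \<open>t\<close>.\<close>

definition scaled_sqrt :: "real \<Rightarrow> 'a::cstar_algebra \<Rightarrow> 'a" where
  "scaled_sqrt t h = sqrt t *\<^sub>R sqrt_one_minus (1 - h /\<^sub>R t)"

context
  fixes t :: real
  assumes t: "t > 0"
begin

lemma norm_one_minus_scaled:
  fixes h :: "'a::cstar_algebra"
  shows "norm (t *\<^sub>R 1 - h) \<le> t \<longleftrightarrow> norm (1 - h /\<^sub>R t) \<le> 1"
proof -
  have "t *\<^sub>R 1 - h = t *\<^sub>R (1 - h /\<^sub>R t)" using t by (simp add: algebra_simps)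
  then show ?thesis using t by (simp add: mult_le_cancel_left1)
qed

lemma scaled_sqrt_intertwine:
  assumes "norm (t *\<^sub>R 1 - h) \<le> t" "norm (t *\<^sub>R 1 - k) \<le> t" "z * h = k * z"
  shows "z * scaled_sqrt t h = scaled_sqrt t k * z"
proof -
  have "z * (1 - h /\<^sub>R t) = (1 - k /\<^sub>R t) * z"
    using assms(3) by (simp add: algebra_simps)
  then have "z * sqrt_one_minus (1 - h /\<^sub>R t) = sqrt_one_minus (1 - k /\<^sub>R t) * z"
    using assms(1,2) unfolding norm_one_minus_scaled by (intro sqrt_one_minus_intertwine)
  then show ?thesis by (simp add: scaled_sqrt_def)
qed

context
  fixes h :: "'a::cstar_algebra"
  assumes h: "star h = h" "norm (t *\<^sub>R 1 - h) \<le> t"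
begin

lemma scaled_sqrt_square: "scaled_sqrt t h * scaled_sqrt t h = h"
proof -
  have "norm (1 - h /\<^sub>R t) \<le> 1" using h t by (simp add: norm_one_minus_scaled)
  then have "scaled_sqrt t h * scaled_sqrt t h = (sqrt t * sqrt t) *\<^sub>R (h /\<^sub>R t)"
    by (simp add: scaled_sqrt_def sqrt_one_minus_square)
  then show ?thesis using t by simp
qed

lemma positive_scaled_sqrt: "positive (scaled_sqrt t h)"
proof -
  have x: "norm (1 - h /\<^sub>R t) \<le> 1" using h t by (simp add: norm_one_minus_scaled)
  have "sqrt t *\<^sub>R 1 - scaled_sqrt t h = sqrt t *\<^sub>R (1 - sqrt_one_minus (1 - h /\<^sub>R t))"
    by (simp add: scaled_sqrt_def algebra_simps)
  then have "norm (sqrt t *\<^sub>R 1 - scaled_sqrt t h) \<le> sqrt t"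
    using norm_one_minus_sqrt[OF x] t by (simp add: mult_left_le)
  moreover have "star (scaled_sqrt t h) = scaled_sqrt t h"
    using star_sqrt_one_minus[OF x] h by (simp add: scaled_sqrt_def star_scaleR star_diff)
  ultimately show ?thesis using t by (auto simp: positive_def intro!: exI[of _ "sqrt t"])
qed

end

end

lemma positive_witness:
  assumes "positive h"
  obtains t where "t > 0" "norm (t *\<^sub>R 1 - h) \<le> t"
proof -
  obtain t where "t \<ge> 0" "norm (t *\<^sub>R 1 - h) \<le> t"
    using assms by (auto simp: positive_def)
  then show ?thesis using that[of "t + 1"] positive_shift[of t h "t + 1"] by simp
qed

lemma positive_sqrt:
  assumes "positive h"
  obtains r where "positive r" "r * r = h" "\<forall>z. z * h = h * z \<longrightarrow> z * r = r * z"
proof -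
  obtain t where t: "t > 0" "norm (t *\<^sub>R 1 - h) \<le> t"
    using positive_witness[OF assms] .
  show ?thesis
  proof (rule that)
    show "positive (scaled_sqrt t h)" "scaled_sqrt t h * scaled_sqrt t h = h"
      using t positive_star[OF assms] by (simp_all only: positive_scaled_sqrt scaled_sqrt_square)
    show "\<forall>z. z * h = h * z \<longrightarrow> z * scaled_sqrt t h = scaled_sqrt t h * z"
      using scaled_sqrt_intertwine[OF t(1) t(2) t(2)] by blast
  qed
qed

text \<open>After scaling \<open>r\<close> to \<open>s\<close> of norm at most 1, the root
  \<open>q\<close> of 1 - s^2 commutes with \<open>s\<close> and q^2 + s^2 = 1. Hence q^2 = 1 - s^2
  has norm at most 1, which is the cone condition.\<close>

lemma positive_square:
  fixes r :: "'a::cstar_algebra"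
  assumes r: "star r = r"
  shows "positive (r * r)"
proof -
  \<comment> \<open>The summand 1 allows division by \<open>t\<close> when
    \<open>r = 0\<close>.\<close>
  define t where "t = (norm r)\<^sup>2 + 1"
  have t: "t > 0" "(norm r)\<^sup>2 \<le> t" by (auto simp: t_def add_nonneg_pos)
  define s where "s = sqrt (inverse t) *\<^sub>R r"
  have s: "star s = s" by (simp add: s_def star_scaleR r)
  have ss: "s * s = (r * r) /\<^sub>R t"
    using t by (simp add: s_def)
  have "norm (s * s) = (norm r)\<^sup>2 / t"
    unfolding ss using t by (simp add: norm_square_selfadjoint[OF r] divide_inverse mult.commute)
  then have n: "norm (s * s) \<le> 1" using t by simp
  define q where "q = sqrt_one_minus (s * s)"
  have q: "star q = q"
    unfolding q_def by (rule star_sqrt_one_minus) (simp_all add: n star_mult s)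
  have qq: "q * q = 1 - s * s" unfolding q_def by (rule sqrt_one_minus_square[OF n])
  have "s * q = q * s"
    unfolding q_def by (rule sqrt_one_minus_intertwine) (simp_all add: n mult.assoc)
  then have "(norm q)\<^sup>2 \<le> norm (q * q + s * s)"
    by (intro norm_le_norm_sum_squares q s) simp
  then have "norm (q * q) \<le> 1" unfolding norm_square_selfadjoint[OF q] by (simp add: qq)
  then have "norm (t *\<^sub>R 1 - r * r) \<le> t"
    unfolding qq ss norm_one_minus_scaled[OF t(1)] .
  moreover have "star (r * r) = r * r" by (simp add: star_mult r)
  ultimately show ?thesis using t(1) unfolding positive_def by (meson less_imp_le)
qed

text \<open>Commuting roots of \<open>h\<close> and of c - h have squares summing to c, so
  \<open>norm_le_norm_sum_squares\<close> bounds the first one.\<close>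

lemma positive_norm_le:
  fixes h :: "'a::cstar_algebra"
  assumes "positive h" "positive (c *\<^sub>R 1 - h)"
  shows "norm h \<le> \<bar>c\<bar>"
proof -
  obtain r where r: "positive r" "r * r = h" "\<forall>z. z * h = h * z \<longrightarrow> z * r = r * z"
    using positive_sqrt[OF assms(1)] .
  obtain q where q: "positive q" "q * q = c *\<^sub>R 1 - h"
    "\<forall>z. z * (c *\<^sub>R 1 - h) = (c *\<^sub>R 1 - h) * z \<longrightarrow> z * q = q * z"
    using positive_sqrt[OF assms(2)] .
  have "r * h = h * r" unfolding r(2)[symmetric] by (simp add: mult.assoc)
  then have "r * q = q * r" by (intro q(3)[rule_format]) (simp add: algebra_simps)
  then have "(norm r)\<^sup>2 \<le> norm (r * r + q * q)"
    by (intro norm_le_norm_sum_squares positive_star r(1) q(1))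
  moreover have "norm h = (norm r)\<^sup>2"
    using norm_square_selfadjoint[OF positive_star[OF r(1)]] r(2) by simp
  ultimately show ?thesis by (simp add: r(2) q(2))
qed

lemma positive_antisym:
  assumes "positive h" "positive (- h)"
  shows "h = 0"
  using positive_norm_le[of h 0] assms by simp

lemma positive_norm_mono:
  assumes "positive a" "positive (b - a)"
  shows "norm a \<le> norm b"
proof -
  have "star b = b"
    using positive_star[OF positive_add[OF assms]] by simp
  then have "positive (norm b *\<^sub>R 1 - b + (b - a))"
    by (intro positive_add positive_norm_diff assms)
  then show ?thesis using positive_norm_le[of a "norm b"] assms(1) by simp
qed

text \<open>With the root \<open>r\<close> of \<open>m\<close> the product is the square of the
  self-adjoint \<open>r * d\<close>. This commuting case has to precede
  \<open>positive_conj\<close>, which depends on positivity of \<open>star y * y\<close>.\<close>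

lemma positive_conj_commuting:
  assumes m: "positive m" and d: "star d = d" "d * m = m * d"
  shows "positive (d * m * d)"
proof -
  obtain r where r: "positive r" "r * r = m" "\<forall>z. z * m = m * z \<longrightarrow> z * r = r * z"
    using positive_sqrt[OF m] .
  have c: "d * r = r * d" using r d by blast
  have "star (r * d) = r * d" using c positive_star[OF r(1)] d by (simp add: star_mult)
  then have "positive ((r * d) * (r * d))" by (rule positive_square)
  moreover have "(r * d) * (r * d) = d * m * d"
    by (metis c r(2) mult.assoc)
  ultimately show ?thesis by simp
qed

lemma selfadjoint_square_zero:
  fixes d :: "'a::cstar_algebra"
  assumes "star d = d" "d * d = 0"
  shows "d = 0"
  using norm_square_selfadjoint[OF assms(1)] assms(2) by simp

text \<open>With d = m - n, the relation d (m + n) = 0 makes \<open>d * m * d\<close> and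
  \<open>d * n * d\<close> positive and opposite, so both vanish and d^3 = 0; the C*-identity
  excludes nonzero self-adjoint nilpotents.\<close>

lemma positive_sqrt_unique:
  assumes m: "positive m" and n: "positive n" and eq: "m * m = n * n" and c: "m * n = n * m"
  shows "m = n"
proof -
  define d where "d = m - n"
  have d: "star d = d" by (simp add: d_def star_diff positive_star m n)
  have dm: "d * m = m * d" and dn: "d * n = n * d"
    using c by (simp_all add: d_def algebra_simps)
  have "d * (m + n) = 0" using eq c by (simp add: d_def algebra_simps)
  then have "d * m = - (d * n)" by (simp add: algebra_simps eq_neg_iff_add_eq_0)
  then have neg: "d * m * d = - (d * n * d)" by simp
  have pm: "positive (d * m * d)" by (rule positive_conj_commuting[OF m d dm])
  have pn: "positive (d * n * d)" by (rule positive_conj_commuting[OF n d dn])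
  have "d * m * d = 0"
    using positive_antisym[OF pm] pn by (simp add: neg)
  moreover have "d * n * d = 0" using calculation neg by simp
  ultimately have "d * (m - n) * d = 0" by (simp add: algebra_simps)
  then have "d * d * d = 0" by (simp add: d_def)
  then have "(d * d) * (d * d) = 0" by (metis mult.assoc mult_zero_left)
  then have "d * d = 0" by (intro selfadjoint_square_zero[of "d * d"]) (simp add: star_mult d)
  then have "d = 0" by (rule selfadjoint_square_zero[OF d])
  then show ?thesis by (simp add: d_def)
qed

text \<open>Replaces the fact that \<open>z * star z\<close> and \<open>star z * z\<close> share
  their nonzero spectrum. Since \<open>z\<close> intertwines the squares of the two positive
  elements, it intertwines their roots, which by uniqueness are the elements themselves; the sign
  then forces \<open>z * star z * z = 0\<close>.\<close>

lemma positive_opposite_products: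
  assumes p: "positive (z * star z)" and n: "positive (- (star z * z))"
  shows "z = 0"
proof -
  let ?p = "z * star z" and ?n = "- (star z * z)"
  have pp: "positive (?p * ?p)" and nn: "positive (?n * ?n)"
    by (intro positive_square positive_star p n)+
  obtain t1 where t1: "t1 > 0" "norm (t1 *\<^sub>R 1 - ?p * ?p) \<le> t1"
    using positive_witness[OF pp] .
  obtain t2 where t2: "t2 > 0" "norm (t2 *\<^sub>R 1 - ?n * ?n) \<le> t2"
    using positive_witness[OF nn] .
  \<comment> \<open>A common witness, as \<open>scaled_sqrt_intertwine\<close> requires.\<close>
  define t where "t = max t1 t2"
  have t: "t > 0" "norm (t *\<^sub>R 1 - ?p * ?p) \<le> t" "norm (t *\<^sub>R 1 - ?n * ?n) \<le> t"
    using t1 t2 positive_shift[OF t1(2), of t] positive_shift[OF t2(2), of t]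
    by (auto simp: t_def)
  have sqrt_sq: "scaled_sqrt t (x * x) = x"
    if x: "positive x" "norm (t *\<^sub>R 1 - x * x) \<le> t" for x
  proof (rule positive_sqrt_unique)
    have s: "star (x * x) = x * x" by (simp add: star_mult positive_star x)
    show "positive (scaled_sqrt t (x * x))" by (rule positive_scaled_sqrt[OF t(1) s x(2)])
    show "scaled_sqrt t (x * x) * scaled_sqrt t (x * x) = x * x"
      by (rule scaled_sqrt_square[OF t(1) s x(2)])
    show "scaled_sqrt t (x * x) * x = x * scaled_sqrt t (x * x)"
      by (rule scaled_sqrt_intertwine[OF t(1) x(2) x(2), symmetric]) (simp add: mult.assoc)
  qed (rule x)
  have "z * scaled_sqrt t (?n * ?n) = scaled_sqrt t (?p * ?p) * z"
    by (rule scaled_sqrt_intertwine[OF t(1,3,2)]) (simp add: mult.assoc)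
  then have "z * ?n = ?p * z"
    by (simp only: sqrt_sq[OF p t(2)] sqrt_sq[OF n t(3)])
  then have "z * star z * z = - (z * star z * z)" by (simp add: mult.assoc)
  then have "2 *\<^sub>R (z * star z * z) = 0"
    unfolding scaleR_2 by (simp only: eq_neg_iff_add_eq_0)
  then have "z * star z * z = 0" by simp
  then have "(star z * z) * (star z * z) = 0" by (metis mult.assoc mult_zero_right)
  then have "star z * z = 0"
    by (intro selfadjoint_square_zero[of "star z * z"]) (simp add: star_mult star_star)
  then show "z = 0" using cstar_identity[of z] by simp
qed

text \<open>Kaplansky's argument: \<open>b\<close> is twice the negative part of \<open>star y * y\<close>, and \<open>z = y * b\<close> makes
  \<open>star z * z\<close> negative but \<open>z * star z\<close> positive.\<close>

theorem positive_star_mult_self: "positive (star y * y)"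
proof -
  define a where "a = star y * y"
  have sa: "star a = a" by (simp add: a_def star_mult star_star)
  \<comment> \<open>\<open>m\<close> is the absolute value of \<open>a\<close>; from m^2 = a^2 and
    commutation, (m - a)(m + a) = 0.\<close>
  obtain m where m: "positive m" "m * m = a * a" "\<forall>z. z * (a * a) = (a * a) * z \<longrightarrow> z * m = m * z"
    using positive_sqrt[OF positive_square[OF sa]] .
  have am: "a * m = m * a" by (rule m(3)[rule_format]) (simp add: mult.assoc)
  define b where "b = m - a"
  have sb: "star b = b" by (simp add: b_def star_diff sa positive_star m)
  have bm: "b * m = m * b" and ba: "b * a = - (b * m)"
    using am m(2) by (simp_all add: b_def algebra_simps)
  define z where "z = y * b"
  have "star z * z = b * (star y * y) * b" by (simp add: z_def star_mult sb mult.assoc)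
  also have "\<dots> = - (b * m * b)" unfolding a_def[symmetric] ba by simp
  finally have zz: "- (star z * z) = b * m * b" by simp
  have n: "positive (- (star z * z))"
    unfolding zz by (rule positive_conj_commuting[OF m(1) sb bm])
  \<comment> \<open>Twice the real part of \<open>z\<close> and, up to sign, twice its imaginary
    part: the sum of their squares is 2 (z z* + z* z), so z z* is a sum of squares plus the positive
    -(z* z).\<close>
  define h where "h = z + star z"
  define k where "k = \<i> *\<^sub>C (z - star z)"
  have h: "star h = h" by (simp add: h_def star_add star_star add.commute)
  have k: "star k = k"
  proof -
    have "star k = (- \<i>) *\<^sub>C (star z - z)" by (simp add: k_def star_scaleC star_diff star_star)
    also have "star z - z = (-1) *\<^sub>C (z - star z)"
      using scaleC_of_real[of "-1" "z - star z"] by simp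
    finally show ?thesis by (simp add: scaleC_scaleC k_def)
  qed
  have "k * k = - ((z - star z) * (z - star z))"
    unfolding k_def using scaleC_of_real[of "-1" "(z - star z) * (z - star z)"]
    by (simp add: mult_scaleC_left mult_scaleC_right scaleC_scaleC)
  then have "h * h + k * k = 2 *\<^sub>R (z * star z + star z * z)"
    by (simp add: h_def algebra_simps scaleR_2)
  then have zz': "z * star z = (1/2) *\<^sub>R (h * h + k * k) + - (star z * z)"
    by simp
  have "positive (z * star z)"
    unfolding zz' by (intro positive_add positive_scaleR positive_square h k n) simp
  then have "z = 0" using n by (rule positive_opposite_products)
  then have "a * b = 0" by (simp add: a_def z_def mult.assoc)
  then have "star (a * b) = 0" by simp
  then have "b * a = 0" by (simp add: star_mult sa sb)
  then have "b * b = 0" using ba by (simp add: b_def algebra_simps)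
  then have "b = 0" by (rule selfadjoint_square_zero[OF sb])
  then show ?thesis using m(1) by (simp add: b_def a_def)
qed

lemma positive_iff_star_mult_self: "positive h \<longleftrightarrow> (\<exists>y. h = star y * y)"
  by (metis positive_sqrt positive_star positive_star_mult_self)

lemma positive_conj:
  assumes "positive h"
  shows "positive (star z * h * z)"
proof -
  obtain y where "h = star y * y" using assms positive_iff_star_mult_self by blast
  then have "star z * h * z = star (y * z) * (y * z)" by (simp add: star_mult mult.assoc)
  then show ?thesis by (simp add: positive_star_mult_self)
qed

lemma mat_positive_one_iff: "mat_positive 1 X \<longleftrightarrow> positive (X 0 0)"
  by (auto simp: mat_positive_def positive_iff_star_mult_self)


section \<open>Characters from approximate eigenvectors\<close>

lemma tendsto_scaleC_zero:
  assumes "(f \<longlongrightarrow> (0 :: 'a::cstar_algebra)) F"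
  shows "((\<lambda>n. c *\<^sub>C f n) \<longlongrightarrow> 0) F"
  using tendsto_mult_right_zero[OF tendsto_norm_zero[OF assms], of "cmod c"]
  by (simp add: norm_scaleC[symmetric] tendsto_norm_zero_iff)

text \<open>The algebra acts on itself by left multiplication, and the elements \<open>z n\<close>
  stand in for the vectors of a Hilbert space.\<close>

definition approx_eigen :: "(nat \<Rightarrow> 'a::cstar_algebra) \<Rightarrow> 'a \<Rightarrow> complex \<Rightarrow> bool" where
  "approx_eigen z b l \<longleftrightarrow> (\<lambda>n. b * z n - l *\<^sub>C z n) \<longlonglongrightarrow> 0"

lemma approx_eigen_zero: "approx_eigen z 0 0"
  by (simp add: approx_eigen_def)

lemma approx_eigen_one: "approx_eigen z 1 1"
  by (simp add: approx_eigen_def)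

lemma approx_eigen_add:
  assumes "approx_eigen z a l" "approx_eigen z b m"
  shows "approx_eigen z (a + b) (l + m)"
  using tendsto_add[OF assms[unfolded approx_eigen_def]]
  by (simp add: approx_eigen_def algebra_simps scaleC_add_left)

lemma approx_eigen_scaleC:
  assumes "approx_eigen z a l"
  shows "approx_eigen z (c *\<^sub>C a) (c * l)"
  using tendsto_scaleC_zero[OF assms[unfolded approx_eigen_def], of c]
  by (simp add: approx_eigen_def scaleC_diff_right mult_scaleC_left scaleC_scaleC)

lemma approx_eigen_diff:
  assumes "approx_eigen z a l" "approx_eigen z b m"
  shows "approx_eigen z (a - b) (l - m)"
  using tendsto_diff[OF assms[unfolded approx_eigen_def]]
  by (simp add: approx_eigen_def algebra_simps scaleC_diff_left)

lemma approx_eigen_mult: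
  assumes "approx_eigen z a l" "approx_eigen z b m"
  shows "approx_eigen z (a * b) (l * m)"
proof -
  have "(\<lambda>n. a * (b * z n - m *\<^sub>C z n) + m *\<^sub>C (a * z n - l *\<^sub>C z n)) \<longlonglongrightarrow> a * 0 + 0"
    by (intro tendsto_intros tendsto_scaleC_zero assms[unfolded approx_eigen_def])
  then show ?thesis
    by (simp add: approx_eigen_def right_diff_distrib mult.assoc mult_scaleC_right
        scaleC_diff_right scaleC_scaleC mult.commute[of m l])
qed

context
  fixes z :: "nat \<Rightarrow> 'a::cstar_algebra"
  assumes norm_z: "\<And>n. norm (z n) = 1"
begin

text \<open>Because \<open>norm (z n) = 1\<close>, the eigenvalue is visible in the norm of
  \<open>b * z n\<close>. Applied to differences, the bound yields uniqueness and Lipschitz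
  dependence on \<open>b\<close>.\<close>

lemma approx_eigen_bound:
  assumes "approx_eigen z b l"
  shows "cmod l \<le> norm b"
proof (rule tendsto_lowerbound)
  show "(\<lambda>n. norm b + norm (b * z n - l *\<^sub>C z n)) \<longlonglongrightarrow> norm b"
    using tendsto_add[OF tendsto_const tendsto_norm_zero[OF assms[unfolded approx_eigen_def]], of "norm b"]
    by simp
  have "cmod l \<le> norm b + norm (b * z n - l *\<^sub>C z n)" for n
  proof -
    have "cmod l = norm (l *\<^sub>C z n)" by (simp add: norm_scaleC norm_z)
    also have "\<dots> \<le> norm (b * z n) + norm (b * z n - l *\<^sub>C z n)"
      using norm_triangle_ineq4[of "b * z n" "b * z n - l *\<^sub>C z n"] by simp
    also have "norm (b * z n) \<le> norm b"
      using norm_mult_ineq[of b "z n"] by (simp add: norm_z)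
    finally show ?thesis by simp
  qed
  then show "\<forall>\<^sub>F n in sequentially. cmod l \<le> norm b + norm (b * z n - l *\<^sub>C z n)" by simp
qed simp

lemma approx_eigen_unique:
  assumes "approx_eigen z b l" "approx_eigen z b m"
  shows "l = m"
  using approx_eigen_bound[OF approx_eigen_diff[OF assms]] by simp

lemma approx_eigen_limit:
  assumes b: "b \<longlonglongrightarrow> c" and l: "l \<longlonglongrightarrow> m" and e: "\<And>k. approx_eigen z (b k) (l k)"
  shows "approx_eigen z c m"
  unfolding approx_eigen_def
proof (rule tendsto_norm_zero_cancel, rule LIMSEQ_I)
  fix r :: real
  assume r: "r > 0"
  have "(\<lambda>k. norm (c - b k) + cmod (l k - m)) \<longlonglongrightarrow> norm (c - c) + cmod (m - m)"
    by (intro tendsto_intros b l)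
  then have "\<forall>\<^sub>F k in sequentially. norm (c - b k) + cmod (l k - m) < r / 2"
    by (rule order_tendstoD) (use r in simp)
  then obtain k where k: "norm (c - b k) + cmod (l k - m) < r / 2"
    by (auto simp: eventually_sequentially)
  obtain N where N: "\<And>n. n \<ge> N \<Longrightarrow> norm (b k * z n - l k *\<^sub>C z n) < r / 2"
    using LIMSEQ_D[OF e[of k, unfolded approx_eigen_def], of "r / 2"] r by auto
  have "norm (c * z n - m *\<^sub>C z n) < r" if n: "n \<ge> N" for n
  proof -
    have "c * z n - m *\<^sub>C z n
        = (c - b k) * z n + (b k * z n - l k *\<^sub>C z n) + (l k - m) *\<^sub>C z n"
      by (simp add: algebra_simps scaleC_diff_left)
    moreover have "norm ((c - b k) * z n) \<le> norm (c - b k)"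
      using norm_mult_ineq[of "c - b k" "z n"] by (simp add: norm_z)
    moreover have "norm ((l k - m) *\<^sub>C z n) = cmod (l k - m)"
      by (simp add: norm_scaleC norm_z)
    ultimately show ?thesis
      using norm_triangle_ineq[of "(c - b k) * z n + (b k * z n - l k *\<^sub>C z n)" "(l k - m) *\<^sub>C z n"]
        norm_triangle_ineq[of "(c - b k) * z n" "b k * z n - l k *\<^sub>C z n"] N[OF n] k
      by simp
  qed
  then show "\<exists>N. \<forall>n\<ge>N. norm (norm (c * z n - m *\<^sub>C z n) - 0) < r" by auto
qed

text \<open>An eigenvector of \<open>b\<close> need not be one of \<open>star b\<close>; imposing
  the condition on both, with conjugate eigenvalues, makes the set closed under
  \<open>star\<close>.\<close>

lemma cstar_subalgebra_approx_eigen: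
  "cstar_subalgebra {b. \<exists>l. approx_eigen z b l \<and> approx_eigen z (star b) (cnj l)}"
    (is "cstar_subalgebra ?D")
  unfolding cstar_subalgebra_def
proof (intro conjI ballI allI)
  show "0 \<in> ?D" using approx_eigen_zero[of z] by (auto intro!: exI[of _ 0])
next
  fix x y assume "x \<in> ?D" "y \<in> ?D"
  then obtain l m where "approx_eigen z x l" "approx_eigen z (star x) (cnj l)"
    "approx_eigen z y m" "approx_eigen z (star y) (cnj m)" by blast
  then have "approx_eigen z (x + y) (l + m) \<and> approx_eigen z (star (x + y)) (cnj (l + m))"
    "approx_eigen z (x * y) (l * m) \<and> approx_eigen z (star (x * y)) (cnj (l * m))"
    using approx_eigen_mult[of z "star y" "cnj m" "star x" "cnj l"]
    by (simp_all add: star_add star_mult approx_eigen_add approx_eigen_mult mult.commute)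
  then show "x + y \<in> ?D" "x * y \<in> ?D" by blast+
next
  fix c x assume "x \<in> ?D"
  then obtain l where "approx_eigen z x l" "approx_eigen z (star x) (cnj l)" by blast
  then show "c *\<^sub>C x \<in> ?D"
    using approx_eigen_scaleC[of z x l c] approx_eigen_scaleC[of z "star x" "cnj l" "cnj c"]
    by (auto simp: star_scaleC intro!: exI[of _ "c * l"])
next
  fix x assume "x \<in> ?D"
  then obtain l where "approx_eigen z x l" "approx_eigen z (star x) (cnj l)" by blast
  then show "star x \<in> ?D" by (auto simp: star_star intro!: exI[of _ "cnj l"])
next
  show "closed ?D"
    unfolding closed_sequential_limits
  proof (intro allI impI, elim conjE)
    fix b c assume "\<forall>k. b k \<in> ?D" and lim: "b \<longlonglongrightarrow> c"
    then obtain l where l: "\<And>k. approx_eigen z (b k) (l k)"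
      "\<And>k. approx_eigen z (star (b k)) (cnj (l k))"
      by simp metis
    \<comment> \<open>Distances of eigenvalues are at most distances of the elements
      \<open>b k\<close>.\<close>
    have "Cauchy l"
      unfolding Cauchy_def
    proof (intro allI impI)
      fix r :: real assume "r > 0"
      then obtain N where "\<forall>m\<ge>N. \<forall>n\<ge>N. dist (b m) (b n) < r"
        using LIMSEQ_imp_Cauchy[OF lim] unfolding Cauchy_def by blast
      moreover have "dist (l m) (l n) \<le> dist (b m) (b n)" for m n
        using approx_eigen_bound[OF approx_eigen_diff[OF l(1) l(1)]] by (simp add: dist_norm)
      ultimately show "\<exists>N. \<forall>m\<ge>N. \<forall>n\<ge>N. dist (l m) (l n) < r"
        by (meson le_less_trans)
    qed
    then obtain L where L: "l \<longlonglongrightarrow> L" by (auto simp: Cauchy_convergent_iff convergent_def)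
    have "approx_eigen z c L" by (rule approx_eigen_limit[OF lim L l(1)])
    moreover have "approx_eigen z (star c) (cnj L)"
      by (rule approx_eigen_limit[OF tendsto_star[OF lim] tendsto_cnj[OF L] l(2)])
    ultimately show "c \<in> ?D" by blast
  qed
qed

lemma approx_eigen_character:
  assumes "cstar_subalgebra hull G = UNIV"
    and "\<And>a. a \<in> G \<Longrightarrow> \<exists>l. approx_eigen z a l \<and> approx_eigen z (star a) (cnj l)"
  obtains \<psi> :: "'a \<Rightarrow> complex" where "star_hom \<psi>" "\<forall>b. approx_eigen z b (\<psi> b)"
proof -
  have "cstar_subalgebra hull G \<subseteq> {b. \<exists>l. approx_eigen z b l \<and> approx_eigen z (star b) (cnj l)}"
    by (rule hull_minimal) (use assms(2) cstar_subalgebra_approx_eigen in auto)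
  then have "\<forall>b. \<exists>l. approx_eigen z b l \<and> approx_eigen z (star b) (cnj l)"
    using assms(1) by blast
  then obtain \<psi> where \<psi>: "\<And>b. approx_eigen z b (\<psi> b)" "\<And>b. approx_eigen z (star b) (cnj (\<psi> b))"
    by metis
  have "star_hom \<psi>"
    unfolding star_hom_def scaleC_complex_def star_complex_def
    using approx_eigen_unique[OF \<psi>(1)] \<psi> approx_eigen_add approx_eigen_mult approx_eigen_scaleC
    by metis
  then show ?thesis using \<psi>(1) that by blast
qed

end

section \<open>Powers of a peaking element\<close>

text \<open>The C*-identity handles the exponents 2^k. For other exponents, e^n divides e^(2^n), and
  the complementary factor has norm at most 1.\<close>

lemma norm_power_selfadjoint:
  fixes e :: "'a::cstar_algebra"
  assumes "star e = e" "norm e = 1"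
  shows "norm (e ^ n) = 1"
proof -
  have two: "norm (e ^ (2 ^ k)) = 1" for k
  proof (induction k)
    case (Suc k)
    have "star (e ^ (2 ^ k)) = e ^ (2 ^ k)" by (simp add: star_power assms)
    then show ?case
      using norm_square_selfadjoint[of "e ^ (2 ^ k)"] Suc by (simp add: mult_2 power_add)
  qed (simp add: assms)
  have le: "norm (e ^ k) \<le> 1" for k
    using norm_power_ineq[of e k] assms(2) by simp
  have "n \<le> 2 ^ n" by (simp add: less_imp_le)
  then have "e ^ (2 ^ n) = e ^ n * e ^ (2 ^ n - n)" by (simp flip: power_add)
  then have "1 \<le> norm (e ^ n) * norm (e ^ (2 ^ n - n))"
    by (metis norm_mult_ineq two)
  also have "\<dots> \<le> norm (e ^ n) * 1" by (intro mult_left_mono le) simp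
  finally show ?thesis using le[of n] by simp
qed

text \<open>The elements \<open>Q k\<close> decrease, and the sum of \<open>Q k\<close> over k < n
  is dominated by the telescoping sum 1 - e^(2n). Hence n Q(n) is at most 1 - e^(2n), and so at most
  1.\<close>

lemma norm_power_times_one_minus:
  fixes e :: "'a::cstar_algebra"
  assumes e: "positive e" "positive (1 - e)"
  shows "real m * norm (e ^ m * (1 - e) * e ^ m) \<le> 1"
proof -
  define Q where "Q n = e ^ n * (1 - e) * e ^ n" for n
  have s: "star (e ^ n) = e ^ n" for n by (simp add: star_power positive_star e)
  have conj: "positive (e ^ n * h * e ^ n)" if "positive h" for n h
    using positive_conj[OF that, of "e ^ n"] by (simp add: s)
  have Q: "positive (Q n)" for n unfolding Q_def by (rule conj) (rule e)
  have s1: "star (1 - e) = 1 - e" by (simp add: star_diff positive_star e)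
  \<comment> \<open>Both summands are conjugates by 1 - e; together they equal (1 - e)(1 - e^2),
    whence \<open>Q\<close> decreases.\<close>
  have "positive (star (1 - e) * 1 * (1 - e) + star (1 - e) * e * (1 - e))"
    by (intro positive_add positive_conj e) (use positive_square[of "1 :: 'a"] in simp)
  then have dec: "positive ((1 - e) - e * (1 - e) * e)"
    by (simp add: s1 algebra_simps)
  obtain r where r: "positive r" "r * r = e" "\<forall>z. z * e = e * z \<longrightarrow> z * r = r * z"
    using positive_sqrt[OF e(1)] .
  have re: "r * e = e * r" unfolding r(2)[symmetric] by (simp add: mult.assoc)
  have "positive (star r * (1 - e) * r)" by (intro positive_conj e)
  moreover have "star r * (1 - e) * r = e - e * e"
    using re by (simp add: positive_star r(1) algebra_simps r(2))
  ultimately have ee: "positive (e - e * e)" by simp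
  have "positive (1 - e ^ n * e ^ n - real n *\<^sub>R Q n)" for n
  proof (induction n)
    case 0
    then show ?case using positive_square[of "0 :: 'a"] by simp
  next
    case (Suc n)
    have Q_Suc: "Q (Suc n) = e ^ n * (e * (1 - e) * e) * e ^ n"
      unfolding Q_def by (metis mult.assoc power_Suc power_Suc2)
    have pw: "e ^ Suc n * e ^ Suc n = e ^ n * (e * e) * e ^ n"
      by (metis mult.assoc power_Suc power_Suc2)
    have "1 - e ^ Suc n * e ^ Suc n - real (Suc n) *\<^sub>R Q (Suc n)
        = (1 - e ^ n * e ^ n - real n *\<^sub>R Q n) + e ^ n * (e - e * e) * e ^ n
          + real (Suc n) *\<^sub>R (e ^ n * ((1 - e) - e * (1 - e) * e) * e ^ n)"
    proof -
      have a: "e ^ n * (e - e * e) * e ^ n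
          = e ^ n * e ^ n - e ^ n * (e * e) * e ^ n - Q n"
        unfolding Q_def by (simp only: left_diff_distrib right_diff_distrib mult_1_right) simp
      have b: "e ^ n * ((1 - e) - e * (1 - e) * e) * e ^ n = Q n - Q (Suc n)"
        unfolding Q_Suc unfolding Q_def by (simp only: left_diff_distrib right_diff_distrib)
      show ?thesis
        unfolding a b pw by (simp add: scaleR_right_diff_distrib scaleR_left_distrib)
    qed
    then show ?case by (simp only:) (intro positive_add positive_scaleR conj Suc ee dec; simp)
  qed
  then have "positive ((1 - e ^ m * e ^ m - real m *\<^sub>R Q m) + e ^ m * e ^ m)"
    by (intro positive_add positive_square s)
  then have "norm (real m *\<^sub>R Q m) \<le> norm (1 :: 'a)"
    by (intro positive_norm_mono positive_scaleR Q) simp_all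
  then show ?thesis by (simp add: Q_def)
qed

text \<open>Writing \<open>p = star y * y\<close>, the C*-identity turns
  \<open>norm (y * e ^ n)\<close> squared into the norm of \<open>e ^ n * p * e ^ n\<close>.
  Conjugation preserves the order whether or not \<open>p\<close> commutes with \<open>e\<close>, so
  the bound c/n follows.\<close>

lemma peak_annihilates:
  fixes e :: "'a::cstar_algebra"
  assumes e: "positive e" "positive (1 - e)" and p: "positive p" "positive (c *\<^sub>R (1 - e) - p)"
  shows "(\<lambda>n. p * e ^ n) \<longlonglongrightarrow> 0"
proof -
  obtain y where y: "p = star y * y" using p(1) positive_iff_star_mult_self by blast
  have s: "star (e ^ n) = e ^ n" for n by (simp add: star_power positive_star e)
  have "(norm (y * e ^ n))\<^sup>2 \<le> \<bar>c\<bar> / real n" if "n > 0" for n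
  proof -
    have "(norm (y * e ^ n))\<^sup>2 = norm (e ^ n * p * e ^ n)"
      unfolding cstar_identity[symmetric] by (simp add: star_mult s y mult.assoc)
    also have "\<dots> \<le> norm (c *\<^sub>R (e ^ n * (1 - e) * e ^ n))"
    proof (rule positive_norm_mono)
      show "positive (e ^ n * p * e ^ n)" using positive_conj[OF p(1), of "e ^ n"] by (simp add: s)
      have "positive (e ^ n * (c *\<^sub>R (1 - e) - p) * e ^ n)"
        using positive_conj[OF p(2), of "e ^ n"] by (simp add: s)
      then show "positive (c *\<^sub>R (e ^ n * (1 - e) * e ^ n) - e ^ n * p * e ^ n)"
        by (simp add: left_diff_distrib right_diff_distrib scaleR_right_diff_distrib)
    qed
    also have "\<dots> \<le> \<bar>c\<bar> * (1 / real n)"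
      unfolding norm_scaleR
    proof (rule mult_left_mono)
      show "norm (e ^ n * (1 - e) * e ^ n) \<le> 1 / real n"
        using norm_power_times_one_minus[OF e, of n] that
        by (simp only: pos_le_divide_eq of_nat_0_less_iff mult.commute)
    qed simp
    finally show ?thesis by simp
  qed
  then have "\<forall>\<^sub>F n in sequentially. norm ((norm (y * e ^ n))\<^sup>2) \<le> \<bar>c\<bar> / real n"
    by (intro eventually_sequentiallyI[of 1]) simp
  then have "(\<lambda>n. (norm (y * e ^ n))\<^sup>2) \<longlonglongrightarrow> 0"
    by (rule Lim_null_comparison) (rule lim_const_over_n)
  then have "(\<lambda>n. y * e ^ n) \<longlonglongrightarrow> 0"
    by (simp add: tendsto_norm_zero_iff)
  then show ?thesis
    using tendsto_mult_right_zero[of "\<lambda>n. y * e ^ n" sequentially "star y"]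
    by (simp add: y mult.assoc)
qed

text \<open>The hypothesis \<open>pos\<close> says that \<open>1, u, v\<close> are ordered like the coordinate functions on the
  square \<open>{1, -1} \<times> {1, -1}\<close>. The element \<open>e\<close> corresponds to the affine function peaking
  at the corner \<open>(x, y)\<close>, so its powers are approximate joint eigenvectors of \<open>u\<close> and \<open>v\<close>.\<close>

lemma corner_character:
  fixes u v :: "'a::cstar_algebra"
  assumes pos: "\<And>a b c. positive (a *\<^sub>R 1 + b *\<^sub>R u + c *\<^sub>R v) \<longleftrightarrow>
      (\<forall>x\<in>{1,-1}. \<forall>y\<in>{1,-1}. a + b * x + c * y \<ge> (0::real))"
    and gen: "cstar_subalgebra hull {a *\<^sub>C 1 + b *\<^sub>C u + c *\<^sub>C v | a b c. True} = UNIV"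
    and x: "x \<in> {1, -1 :: real}" and y: "y \<in> {1, -1 :: real}"
  obtains \<psi> :: "'a \<Rightarrow> complex" where "star_hom \<psi>" "\<psi> 1 = 1" "\<psi> u = of_real x" "\<psi> v = of_real y"
proof -
  define e where "e = (1/2) *\<^sub>R 1 + (x/4) *\<^sub>R u + (y/4) *\<^sub>R v"
  have e: "positive e" unfolding e_def pos using x y by auto
  have half: "(1/2) *\<^sub>R 1 = 1 - (1/2) *\<^sub>R (1 :: 'a)"
    by (simp add: eq_diff_eq flip: scaleR_left_distrib)
  have "1 - e = (1/2) *\<^sub>R 1 + (-x/4) *\<^sub>R u + (-y/4) *\<^sub>R v"
    by (subst half) (simp add: e_def)
  moreover have "positive \<dots>" unfolding pos using x y by auto
  ultimately have e1: "positive (1 - e)" by simp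
  have "norm e = 1"
  proof (rule antisym)
    show "norm e \<le> 1" using positive_norm_le[OF e, of 1] e1 by simp
    \<comment> \<open>The lower bound reads this positivity through \<open>pos\<close> at the corner
      \<open>(x, y)\<close>, where the affine function has value \<open>norm e - 1\<close>.\<close>
    have "positive (norm e *\<^sub>R 1 - e)" by (intro positive_norm_diff positive_star e)
    then have "positive ((norm e - 1/2) *\<^sub>R 1 + (-x/4) *\<^sub>R u + (-y/4) *\<^sub>R v)"
      by (simp add: e_def algebra_simps)
    then have "norm e - 1/2 + (-x/4) * x + (-y/4) * y \<ge> 0" unfolding pos using x y by blast
    then show "1 \<le> norm e" using x y by auto
  qed
  then have norm_e: "norm (e ^ n) = 1" for n
    by (intro norm_power_selfadjoint positive_star e)
  have pu: "positive (1 + (-x) *\<^sub>R u)" and pv: "positive (1 + (-y) *\<^sub>R v)"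
    using pos[of 1 "-x" 0] pos[of 1 0 "-y"] x y by auto
  have su: "star u = u" and sv: "star v = v"
    using positive_star[OF pu] positive_star[OF pv] x y
    by (auto simp: star_add star_scaleR star_minus star_diff)
  \<comment> \<open>Source of the constant 4: each of the two positive summands is dominated by 4 (1
    - e).\<close>
  have sum4: "4 *\<^sub>R (1 - e) = (1 + (-x) *\<^sub>R u) + (1 + (-y) *\<^sub>R v)"
    by (simp add: e_def algebra_simps) (simp add: scaleR_conv_of_real)
  \<comment> \<open>Since t^2 = 1, multiplying 1 - t w by -t gives w - t.\<close>
  have eigen: "approx_eigen ((^) e) w (of_real t)"
    if "(\<lambda>n. (1 + (-t) *\<^sub>R w) * e ^ n) \<longlonglongrightarrow> 0" "t \<in> {1, -1}" for w t
  proof -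
    have "(\<lambda>n. (- t) *\<^sub>R ((1 + (-t) *\<^sub>R w) * e ^ n)) \<longlonglongrightarrow> (- t) *\<^sub>R 0"
      by (intro tendsto_intros that)
    moreover have "(- t) *\<^sub>R ((1 + (-t) *\<^sub>R w) * e ^ n) = w * e ^ n - of_real t *\<^sub>C e ^ n" for n
      using that(2) by (auto simp: algebra_simps scaleC_of_real)
    ultimately show ?thesis by (simp add: approx_eigen_def)
  qed
  have eu: "approx_eigen ((^) e) u (of_real x)" and ev: "approx_eigen ((^) e) v (of_real y)"
    by (intro eigen x y peak_annihilates[OF e e1, of _ 4]; simp add: sum4 pu pv del: scaleR_minus_left)+
  have gens: "approx_eigen ((^) e) (a *\<^sub>C 1 + b *\<^sub>C u + c *\<^sub>C v) (a * 1 + b * of_real x + c * of_real y)" for a b c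
    by (intro approx_eigen_add approx_eigen_scaleC approx_eigen_one eu ev)
  have G: "\<exists>l. approx_eigen ((^) e) g l \<and> approx_eigen ((^) e) (star g) (cnj l)"
    if g_in: "g \<in> {a *\<^sub>C 1 + b *\<^sub>C u + c *\<^sub>C v | a b c. True}" for g
  proof -
    obtain a b c where g: "g = a *\<^sub>C 1 + b *\<^sub>C u + c *\<^sub>C v" using g_in by blast
    then have "star g = cnj a *\<^sub>C 1 + cnj b *\<^sub>C u + cnj c *\<^sub>C v"
      by (simp add: star_add star_scaleC su sv)
    then have "approx_eigen ((^) e) (star g) (cnj (a * 1 + b * of_real x + c * of_real y))"
      using gens[of "cnj a" "cnj b" "cnj c"] by simp
    then show ?thesis using gens[of a b c] unfolding g by blast
  qed
  obtain \<psi> where hom: "star_hom \<psi>" and \<psi>: "\<forall>b. approx_eigen ((^) e) b (\<psi> b)"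
    using approx_eigen_character[OF norm_e gen G] .
  have "\<psi> b = l" if "approx_eigen ((^) e) b l" for b l
    by (rule approx_eigen_unique[OF norm_e \<psi>[rule_format] that])
  then show ?thesis using that[OF hom] approx_eigen_one eu ev by blast
qed


section \<open>The C*-envelope of \<open>E_V4\<close>\<close>

lemma z2_val_cases: "z2_val s = 1 \<or> z2_val s = -1"
  using z2_val[of s] by auto

lemma z2_cases: "s = 1 \<or> s = (-1 :: z2)"
  using z2_val_cases[of s] by (metis z2_val_inject z2_val_simps(1,2))

lemma all_z2: "(\<forall>s :: z2. P s) \<longleftrightarrow> P 1 \<and> P (-1)"
  by (metis z2_cases)

lemma z2_one_neq [simp]: "(1 :: z2) \<noteq> -1" "(-1 :: z2) \<noteq> 1"
  by (metis z2_val_simps(1,2) one_neq_neg_one)+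

lemma UNIV_z2: "(UNIV :: z2 set) = {1, -1}"
  using z2_cases by auto

lemma UNIV_v4: "(UNIV :: v4 set) = {(1,1), (1,-1), (-1,1), (-1,-1)}"
  using z2_cases by auto

lemma apply_Bcontfun_v4 [simp]: "apply_bcontfun (Bcontfun f) = (f :: v4 \<Rightarrow> complex)"
  by (rule Bcontfun_inverse) (rule v4_all_bcontfun)

definition coord1 :: "v4 \<Rightarrow>\<^sub>C complex" where
  "coord1 = Bcontfun (\<lambda>p. of_int (z2_val (fst p)))"

definition coord2 :: "v4 \<Rightarrow>\<^sub>C complex" where
  "coord2 = Bcontfun (\<lambda>p. of_int (z2_val (snd p)))"

lemma apply_coord [simp]:
  "apply_bcontfun coord1 p = of_int (z2_val (fst p))"
  "apply_bcontfun coord2 p = of_int (z2_val (snd p))"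
  by (simp_all add: coord1_def coord2_def)

lemma E_V4_eq_span: "E_V4 = {a *\<^sub>C 1 + b *\<^sub>C coord1 + c *\<^sub>C coord2 | a b c. True}"
proof -
  have "(\<forall>s t. apply_bcontfun f (s, t) = a + of_int (z2_val s) * b + of_int (z2_val t) * c)
      \<longleftrightarrow> f = a *\<^sub>C 1 + b *\<^sub>C coord1 + c *\<^sub>C coord2" for f a b c
    by (auto intro!: bcontfun_eqI simp: scaleC_complex_def algebra_simps)
  then show ?thesis by (simp only: E_V4_def) blast
qed

text \<open>The equation says that the Fourier coefficient at the character s t of V_4 vanishes.
  Conversely, a0 is the mean of two opposite corners, and a1, a2 are half-differences along
  edges.\<close>

lemma E_V4_iff: "f \<in> E_V4 \<longleftrightarrow>
   apply_bcontfun f (1, 1) + apply_bcontfun f (-1, -1) = apply_bcontfun f (1, -1) + apply_bcontfun f (-1, 1)"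
    (is "_ \<longleftrightarrow> ?A + ?D = ?B + ?C")
proof
  assume eq: "?A + ?D = ?B + ?C"
  then have D: "?D = ?B + ?C - ?A" by (simp add: algebra_simps)
  have "\<forall>s t. apply_bcontfun f (s, t) =
    (?A + ?D) / 2 + of_int (z2_val s) * ((?A - ?C) / 2) + of_int (z2_val t) * ((?A - ?B) / 2)"
    unfolding all_z2 by (simp add: D field_simps)
  then show "f \<in> E_V4" unfolding E_V4_def by blast
qed (auto simp: E_V4_def)

lemma E_V4_add: "f \<in> E_V4 \<Longrightarrow> g \<in> E_V4 \<Longrightarrow> f + g \<in> E_V4"
  unfolding E_V4_iff by simp algebra

lemma E_V4_scaleC: "f \<in> E_V4 \<Longrightarrow> c *\<^sub>C f \<in> E_V4"
  by (simp add: E_V4_iff scaleC_complex_def flip: distrib_left)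

lemma E_V4_star: "f \<in> E_V4 \<Longrightarrow> star f \<in> E_V4"
  by (simp add: E_V4_iff star_complex_def flip: complex_cnj_add)

lemma E_V4_one: "1 \<in> E_V4"
  by (simp add: E_V4_iff)

lemma coord_in_E_V4: "coord1 \<in> E_V4" "coord2 \<in> E_V4"
  by (simp_all add: E_V4_iff)

lemma continuous_on_apply_point:
  "continuous_on S (\<lambda>f :: 'a::topological_space \<Rightarrow>\<^sub>C 'b::real_normed_vector. apply_bcontfun f p)"
proof -
  have "bounded_linear (\<lambda>f :: 'a \<Rightarrow>\<^sub>C 'b. apply_bcontfun f p)"
    by (rule bounded_linear_intro[of _ 1]) (simp_all add: norm_bounded)
  then show ?thesis by (rule linear_continuous_on)
qed

lemma operator_system_E_V4: "operator_system E_V4"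
proof -
  have E_V4_eq: "E_V4 = {f. apply_bcontfun f (1, 1) + apply_bcontfun f (-1, -1)
      = apply_bcontfun f (1, -1) + apply_bcontfun f (-1, 1)}"
    using E_V4_iff by blast
  have "closed E_V4"
    unfolding E_V4_eq by (intro closed_Collect_eq continuous_intros continuous_on_apply_point)
  then show ?thesis
    by (simp add: operator_system_def E_V4_add E_V4_scaleC E_V4_star E_V4_one)
qed

lemma positive_v4_iff:
  "positive (f :: v4 \<Rightarrow>\<^sub>C complex) \<longleftrightarrow> (\<forall>p. Im (apply_bcontfun f p) = 0 \<and> Re (apply_bcontfun f p) \<ge> 0)"
proof
  assume "positive f"
  then obtain y where "f = star y * y" using positive_iff_star_mult_self by blast
  then show "\<forall>p. Im (apply_bcontfun f p) = 0 \<and> Re (apply_bcontfun f p) \<ge> 0"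
    by (simp add: star_complex_def)
next
  assume f: "\<forall>p. Im (apply_bcontfun f p) = 0 \<and> Re (apply_bcontfun f p) \<ge> 0"
  define y :: "v4 \<Rightarrow>\<^sub>C complex" where "y = Bcontfun (\<lambda>p. of_real (sqrt (Re (apply_bcontfun f p))))"
  have "f = star y * y"
    using f by (intro bcontfun_eqI) (auto simp: y_def star_complex_def complex_eq_iff)
  then show "positive f" using positive_iff_star_mult_self by blast
qed

lemma unital_complete_order_embedding_positive_iff:
  assumes "unital_complete_order_embedding E j" "f \<in> E"
  shows "positive (j f) \<longleftrightarrow> positive f"
proof -
  have "mat_positive 1 (\<lambda>_ _. j f) \<longleftrightarrow> mat_positive 1 (\<lambda>_ _. f)"
    using assms(1)[unfolded unital_complete_order_embedding_def, THEN conjunct2, THEN conjunct2,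
        THEN conjunct2, THEN conjunct2, rule_format, of 1 "\<lambda>_ _. f"] assms(2) by simp
  then show ?thesis unfolding mat_positive_one_iff .
qed

section \<open>Generation of C(V_4) and the universal property\<close>

text \<open>At \<open>coord1\<close> and \<open>coord2\<close> this is four times the indicator
  function of \<open>p\<close>. Leaving \<open>u\<close> and \<open>v\<close> free lets the same
  polynomial be evaluated in \<open>B\<close> to produce preimages.\<close>

definition delta_poly :: "'a::cstar_algebra \<Rightarrow> 'a \<Rightarrow> v4 \<Rightarrow> 'a" where
  "delta_poly u v p = (1 + of_int (z2_val (fst p)) *\<^sub>C u) * (1 + of_int (z2_val (snd p)) *\<^sub>C v)"

lemma sum_v4: "(\<Sum>p\<in>UNIV. g p) = g (1,1) + g (1,-1) + g (-1,1) + g (-1,-1 :: z2)"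
  for g :: "v4 \<Rightarrow> 'a::comm_monoid_add"
  by (simp add: UNIV_v4 add.assoc)

lemma delta_poly_coord: "(\<Sum>p\<in>UNIV. (apply_bcontfun f p / 4) *\<^sub>C delta_poly coord1 coord2 p) = f"
proof (rule bcontfun_eqI)
  fix q
  show "apply_bcontfun (\<Sum>p\<in>UNIV. (apply_bcontfun f p / 4) *\<^sub>C delta_poly coord1 coord2 p) q = apply_bcontfun f q"
    using z2_cases[of "fst q"] z2_cases[of "snd q"]
    by (cases q) (auto simp: sum_v4 delta_poly_def scaleC_complex_def)
qed

lemma cstar_subalgebra_hull: "cstar_subalgebra (cstar_subalgebra hull S)"
proof (rule hull_in)
  fix T :: "'a set set"
  assume "\<forall>s\<in>T. cstar_subalgebra s"
  then show "cstar_subalgebra (\<Inter>T)"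
    unfolding cstar_subalgebra_def by (auto intro!: closed_Inter)
qed

lemma hull_E_V4: "cstar_subalgebra hull E_V4 = UNIV"
proof -
  have D: "cstar_subalgebra (cstar_subalgebra hull E_V4)" (is "cstar_subalgebra ?D")
    by (rule cstar_subalgebra_hull)
  have sub: "f \<in> ?D" if "f \<in> E_V4" for f using hull_subset[of E_V4] that by blast
  have clos: "x + y \<in> ?D" "x * y \<in> ?D" "c *\<^sub>C x \<in> ?D" if "x \<in> ?D" "y \<in> ?D" for c x y
    using D that unfolding cstar_subalgebra_def by auto
  have "delta_poly coord1 coord2 p \<in> ?D" for p
    unfolding delta_poly_def
    by (intro clos(2) sub E_V4_add E_V4_one E_V4_scaleC coord_in_E_V4)
  then have "(\<Sum>p\<in>UNIV. (apply_bcontfun f p / 4) *\<^sub>C delta_poly coord1 coord2 p) \<in> ?D" for f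
    unfolding sum_v4 by (intro clos(1) clos(3))
  then have "f \<in> ?D" for f
    unfolding delta_poly_coord .
  then show ?thesis by blast
qed

lemma unital_complete_order_embedding_id: "unital_complete_order_embedding E (\<lambda>x. x)"
  by (simp add: unital_complete_order_embedding_def)

lemma E_V4_embedding_retraction:
  fixes j :: "(v4 \<Rightarrow>\<^sub>C complex) \<Rightarrow> 'b::cstar_algebra"
  assumes j: "unital_complete_order_embedding E_V4 j" and gen: "cstar_subalgebra hull (j ` E_V4) = UNIV"
  shows "\<exists>\<rho> :: 'b \<Rightarrow> v4 \<Rightarrow>\<^sub>C complex. star_hom \<rho> \<and> surj \<rho> \<and> (\<forall>x\<in>E_V4. \<rho> (j x) = x)"
proof -
  define u where "u = j coord1"
  define v where "v = j coord2"
  have j1: "j 1 = 1" and jadd: "\<And>x y. x \<in> E_V4 \<Longrightarrow> y \<in> E_V4 \<Longrightarrow> j (x + y) = j x + j y"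
    and jscale: "\<And>c x. x \<in> E_V4 \<Longrightarrow> j (c *\<^sub>C x) = c *\<^sub>C j x"
    using j unfolding unital_complete_order_embedding_def by auto
  have lin: "j (a *\<^sub>C 1 + b *\<^sub>C coord1 + c *\<^sub>C coord2) = a *\<^sub>C 1 + b *\<^sub>C u + c *\<^sub>C v" for a b c
    by (simp add: u_def v_def jadd jscale j1 E_V4_add E_V4_one E_V4_scaleC coord_in_E_V4)
  have "j ` E_V4 = {a *\<^sub>C 1 + b *\<^sub>C u + c *\<^sub>C v | a b c. True}"
    unfolding E_V4_eq_span lin[symmetric] by blast
  then have gen': "cstar_subalgebra hull {a *\<^sub>C 1 + b *\<^sub>C u + c *\<^sub>C v | a b c. True} = UNIV"
    using gen by simp
  \<comment> \<open>Positivity in C(V_4) is pointwise, so the order embedding turns it into the four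
    corner inequalities.\<close>
  have pos: "positive (a *\<^sub>R 1 + b *\<^sub>R u + c *\<^sub>R v) \<longleftrightarrow>
      (\<forall>x\<in>{1,-1}. \<forall>y\<in>{1,-1}. a + b * x + c * y \<ge> 0)" for a b c :: real
  proof -
    let ?f = "of_real a *\<^sub>C 1 + of_real b *\<^sub>C coord1 + of_real c *\<^sub>C coord2"
    have "a *\<^sub>R 1 + b *\<^sub>R u + c *\<^sub>R v = j ?f"
      unfolding lin unfolding scaleC_of_real ..
    moreover have "?f \<in> E_V4" unfolding E_V4_eq_span by blast
    ultimately have "positive (a *\<^sub>R 1 + b *\<^sub>R u + c *\<^sub>R v) \<longleftrightarrow> positive ?f"
      by (simp only: unital_complete_order_embedding_positive_iff[OF j])
    then show ?thesis by (simp add: positive_v4_iff all_z2 scaleC_complex_def)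
  qed
  have "\<exists>\<psi> :: 'b \<Rightarrow> complex. star_hom \<psi> \<and> \<psi> 1 = 1 \<and>
      \<psi> u = of_int (z2_val (fst p)) \<and> \<psi> v = of_int (z2_val (snd p))" for p
  proof -
    have "real_of_int (z2_val s) \<in> {1, -1}" for s using z2_val_cases[of s] by auto
    then obtain \<psi> :: "'b \<Rightarrow> complex" where "star_hom \<psi>" "\<psi> 1 = 1"
      "\<psi> u = of_real (real_of_int (z2_val (fst p)))" "\<psi> v = of_real (real_of_int (z2_val (snd p)))"
      using corner_character[OF pos gen'] by metis
    then show ?thesis by auto
  qed
  then obtain \<Psi> :: "v4 \<Rightarrow> 'b \<Rightarrow> complex" where \<Psi>: "\<And>p. star_hom (\<Psi> p)" "\<And>p. \<Psi> p 1 = 1"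
      "\<And>p. \<Psi> p u = of_int (z2_val (fst p))" "\<And>p. \<Psi> p v = of_int (z2_val (snd p))"
    by metis
  define \<rho> :: "'b \<Rightarrow> v4 \<Rightarrow>\<^sub>C complex" where "\<rho> b = Bcontfun (\<lambda>p. \<Psi> p b)" for b
  have hom: "\<rho> (x + y) = \<rho> x + \<rho> y" "\<rho> (c *\<^sub>C x) = c *\<^sub>C \<rho> x" "\<rho> (x * y) = \<rho> x * \<rho> y"
    "\<rho> (star x) = star (\<rho> x)" for x y c
    using \<Psi>(1) unfolding star_hom_def by (auto intro!: bcontfun_eqI simp: \<rho>_def)
  have \<rho>: "\<rho> 1 = 1" "\<rho> u = coord1" "\<rho> v = coord2"
    by (auto intro!: bcontfun_eqI simp: \<rho>_def \<Psi>)
  have "star_hom \<rho>" unfolding star_hom_def using hom by blast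
  moreover have "\<forall>x\<in>E_V4. \<rho> (j x) = x"
    by (auto simp: E_V4_eq_span lin hom \<rho>)
  moreover have "surj \<rho>"
  proof (rule surjI)
    fix f
    \<comment> \<open>A preimage of \<open>f\<close>: its interpolation polynomial, evaluated at
      \<open>u\<close> and \<open>v\<close>.\<close>
    have "\<rho> (\<Sum>p\<in>UNIV. (apply_bcontfun f p / 4) *\<^sub>C delta_poly u v p)
        = (\<Sum>p\<in>UNIV. (apply_bcontfun f p / 4) *\<^sub>C delta_poly coord1 coord2 p)"
      unfolding sum_v4 delta_poly_def hom \<rho> ..
    then show "\<rho> (\<Sum>p\<in>UNIV. (apply_bcontfun f p / 4) *\<^sub>C delta_poly u v p) = f"
      unfolding delta_poly_coord .
  qed
  ultimately show ?thesis by blast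
qed

lemma cstar_envelope_E_V4: "cstar_envelope TYPE('b::cstar_algebra) E_V4 (\<lambda>f. f)"
  using E_V4_embedding_retraction[where 'b = 'b]
  by (auto simp: cstar_envelope_def operator_system_E_V4 unital_complete_order_embedding_id hull_E_V4)


section \<open>Path components of spaces of invertible functions\<close>

lemma pi0_eq: "pi0 S = (\<lambda>x. Collect (path_component S x)) ` S"
proof -
  have "path_component_of (top_of_set S) = path_component S" by (simp add: fun_eq_iff)
  then show ?thesis by (simp add: pi0_def path_components_of_def)
qed

text \<open>A label that is constant on path components and separates them classifies
  \<open>pi0 S\<close>. It is instantiated with sign patterns and, for path connected sets, with a
  constant.\<close>

lemma pi0_label:
  assumes conn: "\<And>x y. x \<in> S \<Longrightarrow> y \<in> S \<Longrightarrow> L x = L y \<Longrightarrow> path_component S x y"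
    and inv: "\<And>x y. path_component S x y \<Longrightarrow> L x = L y"
  shows "\<exists>\<Phi>. bij_betw \<Phi> (pi0 S) (L ` S) \<and> (\<forall>C\<in>pi0 S. \<forall>x\<in>C. \<Phi> C = L x)"
proof -
  define \<Phi> where "\<Phi> C = L (SOME x. x \<in> C)" for C
  have val: "\<Phi> C = L x" if C: "C \<in> pi0 S" and x: "x \<in> C" for C x
  proof -
    obtain a where a: "C = Collect (path_component S a)" using C by (auto simp: pi0_eq)
    have eq: "L a = L y" if "y \<in> C" for y using that unfolding a by (intro inv) simp
    have some: "(SOME x. x \<in> C) \<in> C" using x by (rule someI)
    show ?thesis unfolding \<Phi>_def using eq[OF some] eq[OF x] by (rule trans[OF sym])
  qed
  have mem: "Collect (path_component S x) \<in> pi0 S" "x \<in> Collect (path_component S x)" if "x \<in> S" for x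
    using that by (auto simp: pi0_eq path_component_refl)
  have "inj_on \<Phi> (pi0 S)"
  proof (rule inj_onI)
    fix C D assume C: "C \<in> pi0 S" and D: "D \<in> pi0 S" and eq: "\<Phi> C = \<Phi> D"
    obtain a b where a: "a \<in> S" "C = Collect (path_component S a)"
      and b: "b \<in> S" "D = Collect (path_component S b)" using C D by (auto simp: pi0_eq)
    have "\<Phi> C = L a" by (rule val[OF C]) (use mem(2)[OF a(1)] a(2) in simp)
    moreover have "\<Phi> D = L b" by (rule val[OF D]) (use mem(2)[OF b(1)] b(2) in simp)
    ultimately have "L a = L b" using eq by simp
    then have "path_component S a b" using conn a b by blast
    then show "C = D" unfolding a b by (simp add: path_component_eq)
  qed
  moreover have "\<Phi> ` pi0 S = L ` S"
  proof
    show "\<Phi> ` pi0 S \<subseteq> L ` S"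
      using val[OF mem] unfolding pi0_eq by blast
    show "L ` S \<subseteq> \<Phi> ` pi0 S"
    proof
      fix l assume "l \<in> L ` S"
      then obtain x where x: "x \<in> S" "l = L x" by blast
      have "l = \<Phi> (Collect (path_component S x))" unfolding x(2) using val[OF mem] x(1) by simp
      then show "l \<in> \<Phi> ` pi0 S" using mem(1)[OF x(1)] by (rule image_eqI)
    qed
  qed
  ultimately show ?thesis using val unfolding bij_betw_def by blast
qed

lemma card_pi0_path_connected:
  fixes S :: "'a::topological_space set"
  assumes "path_connected S" "S \<noteq> {}"
  shows "card (pi0 S) = 1"
proof -
  have "\<exists>\<Phi> :: 'a set \<Rightarrow> bool. bij_betw \<Phi> (pi0 S) ((\<lambda>_. True) ` S) \<and> (\<forall>C\<in>pi0 S. \<forall>x\<in>C. \<Phi> C = True)"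
    by (rule pi0_label) (use assms path_connected_component in auto)
  then obtain \<Phi> :: "'a set \<Rightarrow> bool" where "bij_betw \<Phi> (pi0 S) ((\<lambda>_. True) ` S)" by blast
  then have "card (pi0 S) = card ((\<lambda>_. True) ` S)" by (rule bij_betw_same_card)
  moreover have "(\<lambda>_. True) ` S = {True}" using assms(2) by auto
  ultimately show ?thesis by simp
qed

section \<open>Units as nonvanishing functions\<close>

lemma unit_v4_iff: "(\<exists>g. f * g = 1 \<and> g * f = 1) \<longleftrightarrow> (\<forall>p. apply_bcontfun f p \<noteq> 0)"
  for f :: "v4 \<Rightarrow>\<^sub>C complex"
proof
  assume "\<exists>g. f * g = 1 \<and> g * f = 1"
  then obtain g where "f * g = 1" by blast
  then have "apply_bcontfun f p * apply_bcontfun g p = 1" for p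
    by (metis apply_one_bcontfun apply_times_bcontfun)
  then show "\<forall>p. apply_bcontfun f p \<noteq> 0" by (metis mult_zero_left zero_neq_one)
next
  assume f: "\<forall>p. apply_bcontfun f p \<noteq> 0"
  define g :: "v4 \<Rightarrow>\<^sub>C complex" where "g = Bcontfun (\<lambda>p. inverse (apply_bcontfun f p))"
  have "f * g = 1 \<and> g * f = 1" using f by (auto intro!: bcontfun_eqI simp: g_def)
  then show "\<exists>g. f * g = 1 \<and> g * f = 1" by blast
qed

lemma star_v4_iff: "star f = f \<longleftrightarrow> (\<forall>p. Im (apply_bcontfun f p) = 0)"
  for f :: "v4 \<Rightarrow>\<^sub>C complex"
proof -
  have "star f = f \<longleftrightarrow> (\<forall>p. cnj (apply_bcontfun f p) = apply_bcontfun f p)"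
    by (metis apply_star_bcontfun bcontfun_eqI star_complex_def)
  also have "\<dots> \<longleftrightarrow> (\<forall>p. Im (apply_bcontfun f p) = 0)" by (auto simp: complex_eq_iff)
  finally show ?thesis .
qed

text \<open>Parametrised by \<open>V\<close> so that \<open>E_V4\<close> and \<open>UNIV\<close>
  share the arguments on path components.\<close>

definition nonvanishing :: "(v4 \<Rightarrow>\<^sub>C complex) set \<Rightarrow> (v4 \<Rightarrow>\<^sub>C complex) set" where
  "nonvanishing V = {f \<in> V. \<forall>p. apply_bcontfun f p \<noteq> 0}"

definition nonvanishing_real :: "(v4 \<Rightarrow>\<^sub>C complex) set \<Rightarrow> (v4 \<Rightarrow>\<^sub>C complex) set" where
  "nonvanishing_real V = {f \<in> nonvanishing V. \<forall>p. Im (apply_bcontfun f p) = 0}"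

lemma units_v4_eq:
  "cstar_units = nonvanishing UNIV" "cstar_units_sa = nonvanishing_real UNIV"
  "env_units E (\<lambda>f. f) = nonvanishing E" "env_units_sa E (\<lambda>f. f) = nonvanishing_real E"
  by (auto simp: cstar_units_def cstar_units_sa_def env_units_def env_units_sa_def
      nonvanishing_def nonvanishing_real_def unit_v4_iff star_v4_iff)

definition sign_pattern :: "(v4 \<Rightarrow>\<^sub>C complex) \<Rightarrow> v4 \<Rightarrow> real" where
  "sign_pattern f = (\<lambda>p. sgn (Re (apply_bcontfun f p)))"

lemma convex_combination_nonzero:
  fixes a b u :: real
  assumes "sgn a = sgn b" "a \<noteq> 0" "0 \<le> u" "u \<le> 1"
  shows "(1 - u) * a + u * b \<noteq> 0"
proof (cases "a > 0")
  case True
  then have "b > 0" using assms by (auto simp: sgn_if split: if_splits)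
  then have "(1 - u) * a + u * b > 0"
    using True assms by (cases "u = 0") (auto intro: add_nonneg_pos)
  then show ?thesis by simp
next
  case False
  then have "a < 0" "b < 0" using assms by (auto simp: sgn_if split: if_splits)
  then have "(1 - u) * a + u * b < 0"
    using assms by (cases "u = 0") (auto intro: add_nonpos_neg simp: mult_le_0_iff mult_less_0_iff)
  then show ?thesis by simp
qed

text \<open>Equal signs persist along the straight segment, which stays in the convex
  \<open>V\<close>; conversely, evaluation at a point is continuous and real nonzero, so its sign is
  constant on a path component.\<close>

lemma pi0_nonvanishing_real:
  assumes V: "convex V"
  shows "\<exists>\<Phi>. bij_betw \<Phi> (pi0 (nonvanishing_real V)) (sign_pattern ` nonvanishing_real V) \<and>
    (\<forall>C\<in>pi0 (nonvanishing_real V). \<forall>f\<in>C. \<Phi> C = sign_pattern f)"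
proof (rule pi0_label)
  fix f g
  assume f: "f \<in> nonvanishing_real V" and g: "g \<in> nonvanishing_real V"
    and eq: "sign_pattern f = sign_pattern g"
  have "closed_segment f g \<subseteq> nonvanishing_real V"
  proof
    fix h assume h: "h \<in> closed_segment f g"
    then obtain u where u: "0 \<le> u" "u \<le> 1" "h = (1 - u) *\<^sub>R f + u *\<^sub>R g"
      by (auto simp: in_segment)
    have "h \<in> V"
      using h f g closed_segment_subset[OF _ _ V, of f g]
      by (auto simp: nonvanishing_real_def nonvanishing_def)
    moreover have "apply_bcontfun h p \<noteq> 0" "Im (apply_bcontfun h p) = 0" for p
    proof -
      have "Re (apply_bcontfun f p) \<noteq> 0" "Im (apply_bcontfun f p) = 0" "Im (apply_bcontfun g p) = 0"
        using f g
        by (auto simp: nonvanishing_real_def nonvanishing_def complex_eq_iff simp del: split_paired_All)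
      then show "apply_bcontfun h p \<noteq> 0" "Im (apply_bcontfun h p) = 0"
        using convex_combination_nonzero[OF fun_cong[OF eq[unfolded sign_pattern_def], of p] _ u(1,2)]
        by (auto simp: u(3) complex_eq_iff)
    qed
    ultimately show "h \<in> nonvanishing_real V"
      by (simp add: nonvanishing_real_def nonvanishing_def)
  qed
  then show "path_component (nonvanishing_real V) f g" by (rule path_component_linepath)
next
  fix f g
  assume fg: "path_component (nonvanishing_real V) f g"
  let ?T = "Collect (path_component (nonvanishing_real V) f)"
  have T: "f \<in> ?T" "g \<in> ?T" "?T \<subseteq> nonvanishing_real V"
    using fg by (auto intro: path_component_refl dest: path_component_mem)
  show "sign_pattern f = sign_pattern g"
  proof
    fix p
    let ?I = "(\<lambda>h. Re (apply_bcontfun h p)) ` ?T"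
    have conn: "connected ?I"
      by (intro connected_continuous_image path_connected_imp_connected path_connected_path_component
          continuous_on_Re continuous_on_apply_point)
    have "0 \<notin> ?I"
    proof
      assume "0 \<in> ?I"
      then obtain h where "h \<in> nonvanishing_real V" "Re (apply_bcontfun h p) = 0" using T(3) by auto
      then show False
        by (auto simp: nonvanishing_real_def nonvanishing_def complex_eq_iff simp del: split_paired_All)
    qed
    moreover have "Re (apply_bcontfun f p) \<in> ?I" "Re (apply_bcontfun g p) \<in> ?I" using T by blast+
    ultimately have "sgn (Re (apply_bcontfun f p)) = sgn (Re (apply_bcontfun g p))"
      using connectedD_interval[OF conn, of "Re (apply_bcontfun f p)" "Re (apply_bcontfun g p)" 0]
        connectedD_interval[OF conn, of "Re (apply_bcontfun g p)" "Re (apply_bcontfun f p)" 0]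
      by (auto simp: sgn_if)
    then show "sign_pattern f p = sign_pattern g p" by (simp add: sign_pattern_def)
  qed
qed

lemma card_pi0_nonvanishing_real:
  "convex V \<Longrightarrow> card (pi0 (nonvanishing_real V)) = card (sign_pattern ` nonvanishing_real V)"
  using pi0_nonvanishing_real[of V] bij_betw_same_card by blast

text \<open>The complex line through two nonvanishing functions contains only finitely many functions with
  a zero, and the plane minus a finite set is path connected.\<close>

lemma path_connected_nonvanishing:
  assumes add: "\<And>f g. f \<in> V \<Longrightarrow> g \<in> V \<Longrightarrow> f + g \<in> V"
    and scale: "\<And>c f. f \<in> V \<Longrightarrow> c *\<^sub>C f \<in> V"
  shows "path_connected (nonvanishing V)"
  unfolding path_connected_component
proof (intro ballI)
  fix f g
  assume f: "f \<in> nonvanishing V" and g: "g \<in> nonvanishing V"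
  define \<phi> where "\<phi> w = (1 - w) *\<^sub>C f + w *\<^sub>C g" for w
  have \<phi>: "apply_bcontfun (\<phi> w) p = (1 - w) * apply_bcontfun f p + w * apply_bcontfun g p" for w p
    by (simp add: \<phi>_def scaleC_complex_def)
  define K where "K = {w. \<exists>p. apply_bcontfun (\<phi> w) p = 0}"
  have "countable K"
  proof -
    \<comment> \<open>For each \<open>p\<close> the vanishing condition is affine in
      \<open>w\<close> with nonzero constant term, so it has at most one root.\<close>
    have "w = apply_bcontfun f p / (apply_bcontfun f p - apply_bcontfun g p)"
      if w: "apply_bcontfun (\<phi> w) p = 0" for w p
    proof -
      have eq: "w * (apply_bcontfun f p - apply_bcontfun g p) = apply_bcontfun f p"
        using w by (simp add: \<phi> algebra_simps)
      moreover have "apply_bcontfun f p \<noteq> 0" using f by (simp add: nonvanishing_def del: split_paired_All)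
      ultimately have "apply_bcontfun f p - apply_bcontfun g p \<noteq> 0" by auto
      then show ?thesis using eq by (simp add: eq_divide_eq)
    qed
    then have "K \<subseteq> (\<lambda>p. apply_bcontfun f p / (apply_bcontfun f p - apply_bcontfun g p)) ` UNIV"
      unfolding K_def by blast
    then show ?thesis by (meson countable_finite finite_imageI finite_subset finite)
  qed
  then have "path_connected (- K)" by (intro path_connected_complement_countable) simp_all
  moreover have "continuous_on (- K) \<phi>"
  proof -
    have bl: "bounded_linear (\<lambda>w. w *\<^sub>C h)" for h :: "v4 \<Rightarrow>\<^sub>C complex"
    proof (rule bounded_linear_intro[of _ "norm h"])
      show "(r *\<^sub>R w) *\<^sub>C h = r *\<^sub>R (w *\<^sub>C h)" for r w
        using scaleC_of_real[of r "w *\<^sub>C h"] by (simp add: scaleC_scaleC scaleR_conv_of_real[of r w])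
    qed (simp_all add: scaleC_add_left norm_scaleC)
    show ?thesis
      unfolding \<phi>_def
      by (intro continuous_on_add bounded_linear.continuous_on[OF bl] continuous_intros)
  qed
  ultimately have "path_connected (\<phi> ` (- K))" by (rule path_connected_continuous_image[rotated])
  moreover have "f = \<phi> 0" "g = \<phi> 1" by (simp_all add: \<phi>_def)
  moreover have "0 \<in> - K" "1 \<in> - K" using f g by (auto simp: K_def \<phi> nonvanishing_def)
  ultimately have "path_component (\<phi> ` (- K)) f g" unfolding path_connected_component by blast
  moreover have "\<phi> ` (- K) \<subseteq> nonvanishing V"
    using f g by (auto simp: K_def \<phi>_def nonvanishing_def intro!: add scale)
  ultimately show "path_component (nonvanishing V) f g" using path_component_of_subset by blast
qed

section \<open>Sign patterns\<close>

definition sign_functions :: "(v4 \<Rightarrow> real) set" where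
  "sign_functions = {\<sigma>. \<forall>p. \<sigma> p \<in> {1, -1}}"

lemma sign_functions_eq_PiE: "sign_functions = UNIV \<rightarrow>\<^sub>E {1, -1}"
  by (auto simp: sign_functions_def)

lemma card_sign_functions: "card sign_functions = 16"
  unfolding sign_functions_eq_PiE by (subst card_PiE) (simp_all add: UNIV_z2)

lemma sign_pattern_in_sign_functions: "f \<in> nonvanishing_real V \<Longrightarrow> sign_pattern f \<in> sign_functions"
  by (auto simp: sign_pattern_def sign_functions_def nonvanishing_real_def nonvanishing_def
      sgn_if complex_eq_iff)

lemma sign_pattern_realised:
  assumes a: "\<And>p. sgn (a p) = \<sigma> p" and \<sigma>: "\<sigma> \<in> sign_functions"
    and V: "Bcontfun (\<lambda>p. of_real (a p)) \<in> V"
  shows "\<sigma> \<in> sign_pattern ` nonvanishing_real V"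
proof
  show "\<sigma> = sign_pattern (Bcontfun (\<lambda>p. of_real (a p)))"
    by (simp add: sign_pattern_def a)
  have "a p \<noteq> 0" for p
  proof -
    have "\<sigma> p \<in> {1, -1}" using \<sigma> unfolding sign_functions_def by blast
    then show ?thesis using a[of p] by auto
  qed
  then show "Bcontfun (\<lambda>p. of_real (a p)) \<in> nonvanishing_real V"
    using V by (simp add: nonvanishing_real_def nonvanishing_def)
qed

lemma sign_patterns_UNIV: "sign_pattern ` nonvanishing_real UNIV = sign_functions"
proof
  show "sign_functions \<subseteq> sign_pattern ` nonvanishing_real UNIV"
  proof
    fix \<sigma> assume \<sigma>: "\<sigma> \<in> sign_functions"
    have pm: "\<sigma> p = 1 \<or> \<sigma> p = -1" for p using \<sigma> by (simp add: sign_functions_def del: split_paired_All)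
    have "sgn (\<sigma> p) = \<sigma> p" for p using pm[of p] by auto
    then show "\<sigma> \<in> sign_pattern ` nonvanishing_real UNIV"
      by (rule sign_pattern_realised) (use \<sigma> in auto)
  qed
qed (use sign_pattern_in_sign_functions in blast)

text \<open>The character s t of V_4, orthogonal to \<open>E_V4\<close>.\<close>

definition alternating :: "v4 \<Rightarrow> real" where
  "alternating p = of_int (z2_val (fst p) * z2_val (snd p))"

lemma alternating_neq_sign_pattern:
  assumes "f \<in> nonvanishing_real E_V4"
  shows "sign_pattern f \<noteq> alternating" "sign_pattern f \<noteq> - alternating"
proof -
  have "Re (apply_bcontfun f (1, 1)) + Re (apply_bcontfun f (-1, -1))
      = Re (apply_bcontfun f (1, -1)) + Re (apply_bcontfun f (-1, 1))"
    using assms by (simp add: nonvanishing_real_def nonvanishing_def E_V4_iff flip: plus_complex.sel)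
  moreover have "sgn r = 1 \<longleftrightarrow> r > 0" "sgn r = -1 \<longleftrightarrow> r < 0" for r :: real
    by (auto simp: sgn_if)
  ultimately show "sign_pattern f \<noteq> alternating" "sign_pattern f \<noteq> - alternating"
    by (auto simp: fun_eq_iff all_z2 sign_pattern_def alternating_def)
qed

text \<open>When opposite corners have different signs, their values can be shifted to have any sum
  \<open>r\<close> with \<open>\<bar>r\<bar> \<le> 2\<close>, as the other two corners require.\<close>

lemma sign_patterns_E_V4:
  "sign_pattern ` nonvanishing_real E_V4 = sign_functions - {alternating, - alternating}"
proof
  show "sign_pattern ` nonvanishing_real E_V4 \<subseteq> sign_functions - {alternating, - alternating}"
  proof (rule image_subsetI)
    fix f assume f: "f \<in> nonvanishing_real E_V4"
    show "sign_pattern f \<in> sign_functions - {alternating, - alternating}"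
      using sign_pattern_in_sign_functions[OF f] alternating_neq_sign_pattern[OF f] by blast
  qed
  show "sign_functions - {alternating, - alternating} \<subseteq> sign_pattern ` nonvanishing_real E_V4"
  proof
    fix \<sigma> assume "\<sigma> \<in> sign_functions - {alternating, - alternating}"
    then have \<sigma>: "\<sigma> \<in> sign_functions" and ne: "\<sigma> \<noteq> alternating" "\<sigma> \<noteq> - alternating" by auto
    let ?A = "\<sigma> (1, 1)" and ?B = "\<sigma> (1, -1)" and ?C = "\<sigma> (-1, 1)" and ?D = "\<sigma> (-1, -1)"
    have pm: "\<sigma> p \<in> {1, -1}" for p using \<sigma> unfolding sign_functions_def by blast
    have alt: "\<not> (?A = ?D \<and> ?B = ?C \<and> ?A \<noteq> ?B)"
    proof
      assume "?A = ?D \<and> ?B = ?C \<and> ?A \<noteq> ?B"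
      then have "\<sigma> = alternating \<or> \<sigma> = - alternating"
        using pm[of "(1, 1)"] pm[of "(1, -1)"] by (auto simp: fun_eq_iff all_z2 alternating_def)
      then show False using ne by blast
    qed
    have sgn: "sgn (\<sigma> p) = \<sigma> p" for p using pm[of p] by auto
    \<comment> \<open>The shift has modulus at most 1, so the factor 2 protects the sign.\<close>
    have shift: "sgn (2 * \<sigma> p + (\<sigma> q + \<sigma> r) / 2) = \<sigma> p" for p q r
      using pm[of p] pm[of q] pm[of r] by (auto simp: sgn_if)
    have opp: "\<sigma> p + \<sigma> q = 0" if "\<sigma> p \<noteq> \<sigma> q" for p q
      using that pm[of p] pm[of q] by auto
    have "\<exists>a. (\<forall>p. sgn (a p) = \<sigma> p) \<and> a (1, 1) + a (-1, -1) = a (1, -1) + a (-1, 1)"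
    proof -
      \<comment> \<open>If both opposite pairs agree, \<open>alt\<close> leaves only a constant
        \<open>\<sigma>\<close>.\<close>
      consider "?A \<noteq> ?D" | "?B \<noteq> ?C" | "?A = ?D" "?B = ?C" "?A = ?B" using alt by blast
      then show ?thesis
      proof cases
        case 1
        \<comment> \<open>The doubled signs on the diagonal cancel, and the two shifts add up to the
          sum over the other diagonal.\<close>
        define a where "a p = (if fst p = snd p then 2 * \<sigma> p + (?B + ?C) / 2 else \<sigma> p)" for p
        have "sgn (a p) = \<sigma> p" for p unfolding a_def using sgn shift by simp
        moreover have "a (1, 1) + a (-1, -1) = a (1, -1) + a (-1, 1)"
          using opp[OF 1] by (simp add: a_def)
        ultimately show ?thesis by blast
      next
        case 2
        define a where "a p = (if fst p = snd p then \<sigma> p else 2 * \<sigma> p + (?A + ?D) / 2)" for p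
        have "sgn (a p) = \<sigma> p" for p unfolding a_def using sgn shift by simp
        moreover have "a (1, 1) + a (-1, -1) = a (1, -1) + a (-1, 1)"
          using opp[OF 2] by (simp add: a_def)
        ultimately show ?thesis by blast
      next
        case 3
        then have "?A + ?D = ?B + ?C" by simp
        then show ?thesis using sgn by blast
      qed
    qed
    then obtain a where a: "\<And>p. sgn (a p) = \<sigma> p" "a (1, 1) + a (-1, -1) = a (1, -1) + a (-1, 1)"
      by blast
    have "Bcontfun (\<lambda>p. of_real (a p)) \<in> E_V4"
      unfolding E_V4_iff using a(2) by (simp flip: of_real_add)
    then show "\<sigma> \<in> sign_pattern ` nonvanishing_real E_V4"
      by (rule sign_pattern_realised[OF a(1) \<sigma>])
  qed
qed

lemma card_sign_patterns_E_V4: "card (sign_pattern ` nonvanishing_real E_V4) = 14"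
proof -
  have "alternating \<in> sign_functions" "- alternating \<in> sign_functions" "alternating \<noteq> - alternating"
    by (auto simp: sign_functions_def fun_eq_iff all_z2 alternating_def split_paired_all)
  then show ?thesis
    unfolding sign_patterns_E_V4
    by (subst card_Diff_subset) (simp_all add: card_sign_functions)
qed

lemma convex_E_V4: "convex E_V4"
  by (rule convexI) (simp add: E_V4_add E_V4_scaleC flip: scaleC_of_real)

theorem mainTheorem4:
  shows
    "cstar_envelope TYPE('b::cstar_algebra) E_V4 (\<lambda>f. f) \<and>
     (\<exists>\<Phi> :: (v4 \<Rightarrow>\<^sub>C complex) set \<Rightarrow> v4 \<Rightarrow> real.
        bij_betw \<Phi> (pi0 (cstar_units_sa :: (v4 \<Rightarrow>\<^sub>C complex) set)) {\<sigma>. \<forall>p. \<sigma> p \<in> {1, -1}} \<and>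
        (\<forall>C \<in> pi0 cstar_units_sa. \<forall>f\<in>C. \<Phi> C = (\<lambda>p. sgn (Re (apply_bcontfun f p))))) \<and>
     card (pi0 (cstar_units_sa :: (v4 \<Rightarrow>\<^sub>C complex) set)) = 16 \<and>
     card (pi0 (env_units_sa E_V4 (\<lambda>f. f))) = 14 \<and>
     \<not> (\<exists>f \<in> env_units_sa E_V4 (\<lambda>f. f).
          Re (apply_bcontfun f (1, 1)) > 0 \<and> Re (apply_bcontfun f (-1, -1)) > 0 \<and>
          Re (apply_bcontfun f (1, -1)) < 0 \<and> Re (apply_bcontfun f (-1, 1)) < 0) \<and>
     \<not> (\<exists>f \<in> env_units_sa E_V4 (\<lambda>f. f).
          Re (apply_bcontfun f (1, 1)) < 0 \<and> Re (apply_bcontfun f (-1, -1)) < 0 \<and>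
          Re (apply_bcontfun f (1, -1)) > 0 \<and> Re (apply_bcontfun f (-1, 1)) > 0) \<and>
     card (pi0 (env_units E_V4 (\<lambda>f. f))) = 1 \<and>
     card (pi0 (cstar_units :: (v4 \<Rightarrow>\<^sub>C complex) set)) = 1"
proof (intro conjI)
  show "cstar_envelope TYPE('b) E_V4 (\<lambda>f. f)" by (rule cstar_envelope_E_V4)
  show "\<exists>\<Phi> :: (v4 \<Rightarrow>\<^sub>C complex) set \<Rightarrow> v4 \<Rightarrow> real.
        bij_betw \<Phi> (pi0 (cstar_units_sa :: (v4 \<Rightarrow>\<^sub>C complex) set)) {\<sigma>. \<forall>p. \<sigma> p \<in> {1, -1}} \<and>
        (\<forall>C \<in> pi0 cstar_units_sa. \<forall>f\<in>C. \<Phi> C = (\<lambda>p. sgn (Re (apply_bcontfun f p))))"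
    using pi0_nonvanishing_real[OF convex_UNIV]
    unfolding units_v4_eq sign_patterns_UNIV sign_functions_def sign_pattern_def .
  show "card (pi0 (cstar_units_sa :: (v4 \<Rightarrow>\<^sub>C complex) set)) = 16"
    unfolding units_v4_eq card_pi0_nonvanishing_real[OF convex_UNIV] sign_patterns_UNIV
    by (rule card_sign_functions)
  show "card (pi0 (env_units_sa E_V4 (\<lambda>f. f))) = 14"
    unfolding units_v4_eq card_pi0_nonvanishing_real[OF convex_E_V4]
    by (rule card_sign_patterns_E_V4)
  \<comment> \<open>Either forbidden pattern would make one side positive and the other
    negative.\<close>
  have sum: "Re (apply_bcontfun f (1, 1)) + Re (apply_bcontfun f (-1, -1))
      = Re (apply_bcontfun f (1, -1)) + Re (apply_bcontfun f (-1, 1))"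
    if "f \<in> env_units_sa E_V4 (\<lambda>f. f)" for f
    using that unfolding env_units_sa_def env_units_def by (simp add: E_V4_iff flip: plus_complex.sel)
  show "\<not> (\<exists>f \<in> env_units_sa E_V4 (\<lambda>f. f).
          Re (apply_bcontfun f (1, 1)) > 0 \<and> Re (apply_bcontfun f (-1, -1)) > 0 \<and>
          Re (apply_bcontfun f (1, -1)) < 0 \<and> Re (apply_bcontfun f (-1, 1)) < 0)"
    using sum by force
  show "\<not> (\<exists>f \<in> env_units_sa E_V4 (\<lambda>f. f).
          Re (apply_bcontfun f (1, 1)) < 0 \<and> Re (apply_bcontfun f (-1, -1)) < 0 \<and>
          Re (apply_bcontfun f (1, -1)) > 0 \<and> Re (apply_bcontfun f (-1, 1)) > 0)"
    using sum by force
  have one: "1 \<in> nonvanishing E_V4" "1 \<in> nonvanishing UNIV"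
    by (simp_all add: nonvanishing_def E_V4_one)
  show "card (pi0 (env_units E_V4 (\<lambda>f. f))) = 1"
    unfolding units_v4_eq using one
    by (intro card_pi0_path_connected path_connected_nonvanishing E_V4_add E_V4_scaleC) auto
  show "card (pi0 (cstar_units :: (v4 \<Rightarrow>\<^sub>C complex) set)) = 1"
    unfolding units_v4_eq using one
    by (intro card_pi0_path_connected path_connected_nonvanishing) auto
qed

end
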